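(* Let $N\ge 1000$, $M\ge0$ and $h>0$ be real numbers, and let $(u_p)_{M+1\le p\le M+N}$ be complex numbers indexed by the primes in $[M+1,M+N]$. Then $$\int_0^1\Bigl|\sum_{M+1\le p\le M+N}u_p e(p\alpha)\Bigr|^{2+h}d\alpha\le 14000\,\frac{2^h+1/h}{N}\Bigl(\frac{2N}{\log N}\sum_{M+1\le p\le M+N}|u_p|^2\Bigr)^{1+h/2}.$$
   Context: The variable $p$ always denotes a prime number, and sums over $p$ run over primes. We write $e(\alpha)=\exp(2i\pi\alpha)$. *)

theory Defs
  imports "HOL-Analysis.Analysis" "HOL-Computational_Algebra.Primes"
begin

definition e :: "real \<Rightarrow> complex" where
  "e \<alpha> = exp (2 * \<i> * of_real pi * of_real \<alpha>)"

definition primes_between :: "real \<Rightarrow> real \<Rightarrow> nat set" where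
  "primes_between a b = {p. prime p \<and> a \<le> real p \<and> real p \<le> b}"

end

theory Submission
  imports Defs
begin

text \<open>
  Write \<open>S(\<alpha>) = \<Sum> u\<^sub>p e(p\<alpha>)\<close>, \<open>B = \<Sum> \<bar>u\<^sub>p\<bar>\<^sup>2\<close> and \<open>X = 2NB / log N\<close>. Two estimates carry the proof: a
  supremum bound \<open>\<bar>S\<bar>\<^sup>2 \<le> 4X\<close> of Brun-Titchmarsh type, and, for the level set
  \<open>E = {\<bar>S\<bar>\<^sup>2 > X / 4\<^sup>i}\<close>, the bound \<open>N \<integral>\<^sub>E \<bar>S\<bar>\<^sup>2 \<le> (5200 + 1020 i) X\<close>. Since \<open>\<bar>S\<bar>\<^sup>h\<close> is at most
  \<open>(4X)\<^bsup>h/2\<^esup>\<close> times a combination of indicators of level sets with the weights \<open>2\<^bsup>-ih\<^esup> - 2\<^bsup>-(i+1)h\<^esup>\<close>, summation by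
  parts turns the linear growth in \<open>i\<close> into the geometric series \<open>\<Sum> 2\<^bsup>-ih\<^esup>\<close>, which is of order \<open>1 + 1/h\<close>;
  the factor \<open>2\<^sup>h\<close> is \<open>4\<^bsup>h/2\<^esup>\<close> from the supremum. Bounding level sets by their measure only, instead of by
  the \<open>L\<^sup>2\<close> mass of \<open>S\<close> on them, would give \<open>1/h\<^sup>2\<close>.

  Both estimates come from Selberg's sieve in its dual form. Let \<open>z \<ge> 1\<close> and let \<open>a/q\<close> run over the
  fractions whose denominator \<open>q \<le> Q\<close> is squarefree with all prime factors greater than \<open>z\<close>. For a
  prime \<open>n > Q\<close> the Ramanujan sums satisfy \<open>c\<^sub>q(n) = \<mu>(q)\<close>, hence
  \<open>S(\<alpha>) = L\<^bsup>-1\<^esup> \<Sum> \<mu>(q)/\<phi>(q) S(\<alpha> + a/q)\<close> with \<open>L = \<Sum> 1/\<phi>(q)\<close>. Averaging in addition over a window of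
  length \<open>1/N\<close> (\<open>reproducing_identity\<close>) expresses \<open>S\<close> as an average of a comparable exponential sum
  over short intervals around all the points \<open>\<alpha> + a/q\<close>.

  For a single \<open>\<alpha>\<close>, with \<open>z = 1\<close> and \<open>Q\<^sup>2 \<le> N\<close>, these intervals are disjoint, and the Cauchy-Schwarz
  inequality gives the supremum bound. For a set \<open>E\<close> of measure \<open>T/N\<close>, squaring out produces pairs of
  fractions. Equal fractions have total weight \<open>L\<close> and give the main term; the pairs with a given nonzero
  difference have total weight at most \<open>3L/z\<close>, because some prime larger than \<open>z\<close> divides the
  denominator of the difference (\<open>weight_correlation_le\<close>). The outcome is
  \<open>\<integral>\<^sub>E \<bar>S\<bar>\<^sup>2 \<le> 3 B L\<^bsup>-1\<^esup> (1 + 3T/z)\<close> (\<open>restriction_bound\<close>). Finally \<open>log Q \<le> L \<Prod>\<^bsub>p \<le> z\<^esub> (1 - 1/p)\<^bsup>-1\<^esup>\<close>, and the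
  product is \<open>O(log z)\<close>. On the level set \<open>T X \<le> 4\<^sup>i N \<integral>\<^sub>E \<bar>S\<bar>\<^sup>2\<close>, so with \<open>z\<close> a large constant times \<open>8\<^sup>i\<close>
  the term with \<open>T\<close> is absorbed in the left-hand side and a bound linear in \<open>log z\<close>, that is
  in \<open>i\<close>, remains.

  All analysis takes place on the grid of multiples of \<open>1/m\<close>, where \<open>m\<close> is divisible by every prime of the
  sieve, so that the fractions \<open>a/q\<close> lie on the grid and only finite sums occur. Replacing \<open>u\<^sub>p\<close> by
  \<open>u\<^sub>p e(pt)\<close> translates the grid, and integration over \<open>t\<close> recovers the integral.
\<close>

section \<open>A bound for the Euler product over small primes\<close>

lemma sum_ln_prime_factors_le:
  fixes n :: nat
  assumes "n > 0"
  shows "(\<Sum>p\<in>prime_factors n. ln (real p)) \<le> ln (real n)"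
proof -
  have "(\<Prod>p\<in>prime_factors n. p) dvd (\<Prod>p\<in>prime_factors n. p ^ multiplicity p n)"
    by (intro prod_dvd_prod) (auto simp: prime_factors_multiplicity intro!: dvd_power)
  also have "\<dots> = n"
    using assms by (simp add: prod_prime_factors)
  finally have "(\<Prod>p\<in>prime_factors n. p) \<le> n"
    using assms dvd_imp_le by blast
  hence "real (\<Prod>p\<in>prime_factors n. p) \<le> real n"
    by (simp only: of_nat_le_iff)
  hence le: "(\<Prod>p\<in>prime_factors n. real p) \<le> real n"
    by simp
  have pos: "real p > 0" if "p \<in> prime_factors n" for p
    using that by (auto simp: prime_gt_0_nat in_prime_factors_imp_prime)
  have "(\<Sum>p\<in>prime_factors n. ln (real p)) = ln (\<Prod>p\<in>prime_factors n. real p)"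
    using pos by (subst ln_prod) auto
  also have "\<dots> \<le> ln (real n)"
  proof (rule ln_mono)
    show "0 < (\<Prod>p\<in>prime_factors n. real p)" using pos by (intro prod_pos) auto
  qed (use le in auto)
  finally show ?thesis .
qed

text \<open>
  Upper half of a weak form of Mertens' first theorem, from \<open>z ln z \<ge> ln z!\<close>: every prime \<open>p \<le> z\<close>
  divides \<open>\<lfloor>z/p\<rfloor> \<ge> z/(2p)\<close> of the factors of \<open>z!\<close>.
\<close>
lemma sum_ln_prime_over_prime_le:
  fixes z :: nat
  assumes "z \<ge> 1"
  shows "(\<Sum>p | prime p \<and> p \<le> z. ln (real p) / real p) \<le> 2 * ln (real z)"
proof -
  let ?P = "{p. prime p \<and> p \<le> z}"
  have fin: "finite ?P" by simp
  have "real z / 2 * (\<Sum>p\<in>?P. ln (real p) / real p)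
        = (\<Sum>p\<in>?P. ln (real p) * (real z / (2 * real p)))"
    by (simp add: sum_distrib_left mult_ac)
  also have "\<dots> \<le> (\<Sum>p\<in>?P. ln (real p) * card {n\<in>{1..z}. p dvd n})"
  proof (intro sum_mono mult_left_mono)
    fix p assume p: "p \<in> ?P"
    hence p1: "p > 0" "p \<le> z" by (auto simp: prime_gt_0_nat)
    have "real z / (2 * real p) \<le> real (z div p)"
    proof -
      have "z = p * (z div p) + z mod p" by simp
      also have "\<dots> \<le> p * (z div p) + p * (z div p)"
      proof -
        have "z mod p \<le> p" using p1 by (simp add: order_less_imp_le)
        moreover have "z div p \<ge> 1" using p1 by (simp add: div_greater_zero_iff Suc_le_eq)
        ultimately show ?thesis by (metis add_left_mono mult.right_neutral mult_le_mono2 order_trans)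
      qed
      finally have "real z \<le> real (p * (z div p) + p * (z div p))" by (simp only: of_nat_le_iff)
      thus ?thesis using p1 by (simp add: field_simps)
    qed
    also have "z div p = card ((\<lambda>k. p * k) ` {1..z div p})"
      using p1 by (subst card_image) (auto simp: inj_on_def)
    also have "real \<dots> \<le> real (card {n\<in>{1..z}. p dvd n})"
    proof (intro of_nat_mono card_mono)
      show "(\<lambda>k. p * k) ` {1..z div p} \<subseteq> {n \<in> {1..z}. p dvd n}"
      proof
        fix n assume "n \<in> (\<lambda>k. p * k) ` {1..z div p}"
        then obtain k where "n = p * k" "k \<in> {1..z div p}" by blast
        hence k: "n = p * k" "1 \<le> k" "k \<le> z div p" by simp_all
        have "p * k \<le> p * (z div p)" using k by (intro mult_le_mono2)
        hence "p * k \<le> z" by (meson le_trans times_div_less_eq_dividend)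
        thus "n \<in> {n \<in> {1..z}. p dvd n}" using k p1 by auto
      qed
    qed simp
    finally show "real z / (2 * real p) \<le> real (card {n\<in>{1..z}. p dvd n})" .
    show "0 \<le> ln (real p)" using p1 by simp
  qed
  also have "\<dots> = (\<Sum>p\<in>?P. \<Sum>n\<in>{1..z}. if p dvd n then ln (real p) else 0)"
    by (intro sum.cong refl) (simp add: sum.If_cases Int_def mult.commute)
  also have "\<dots> = (\<Sum>n\<in>{1..z}. \<Sum>p\<in>?P. if p dvd n then ln (real p) else 0)"
    by (rule sum.swap)
  also have "\<dots> = (\<Sum>n\<in>{1..z}. \<Sum>p\<in>prime_factors n. ln (real p))"
  proof (rule sum.cong[OF refl])
    fix n assume n: "n \<in> {1..z}"
    have "(\<Sum>p\<in>?P. if p dvd n then ln (real p) else 0) = (\<Sum>p\<in>{p\<in>?P. p dvd n}. ln (real p))"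
      by (rule sum.inter_filter[symmetric]) simp
    also have "{p\<in>?P. p dvd n} = prime_factors n"
      using n dvd_imp_le by (auto simp: in_prime_factors_iff intro: order_trans)
    finally show "(\<Sum>p\<in>?P. if p dvd n then ln (real p) else 0) = (\<Sum>p\<in>prime_factors n. ln (real p))" .
  qed
  also have "\<dots> \<le> (\<Sum>n\<in>{1..z}. ln (real z))"
  proof (intro sum_mono)
    fix n assume "n \<in> {1..z}"
    thus "(\<Sum>p\<in>prime_factors n. ln (real p)) \<le> ln (real z)"
      using sum_ln_prime_factors_le[of n] by (auto intro: order_trans)
  qed
  finally have "real z / 2 * (\<Sum>p\<in>?P. ln (real p) / real p) \<le> real z * ln (real z)" by simp
  thus ?thesis using assms by (simp add: field_simps)
qed

lemma sum_inverse_le_ln: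
  fixes Y :: nat
  assumes "Y \<ge> 1"
  shows "(\<Sum>n\<in>{1..Y}. 1 / real n) \<le> 1 + ln (real Y)"
  using assms
proof (induction Y rule: dec_induct)
  case base
  show ?case by simp
next
  case (step Y)
  have "ln (real Y / real (Suc Y)) \<le> real Y / real (Suc Y) - 1"
    using step by (intro ln_le_minus_one) auto
  moreover have "real Y / real (Suc Y) - 1 = - (1 / real (Suc Y))"
    by (simp add: field_simps)
  ultimately have "1 / real (Suc Y) \<le> ln (real (Suc Y)) - ln (real Y)"
    using step by (simp add: ln_div)
  thus ?case using step by simp
qed

lemma inj_on_prod_primes:
  "inj_on (\<lambda>D. \<Prod>D) {D. finite D \<and> (\<forall>p\<in>D. prime (p::nat))}"
proof (rule inj_onI)
  fix A B :: "nat set"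
  assume A: "A \<in> {D. finite D \<and> (\<forall>p\<in>D. prime p)}" and B: "B \<in> {D. finite D \<and> (\<forall>p\<in>D. prime p)}"
    and eq: "\<Prod>A = \<Prod>B"
  have *: "D = {q. prime q \<and> q dvd \<Prod>D}" if "D \<in> {D. finite D \<and> (\<forall>p\<in>D. prime (p::nat))}" for D
  proof (intro equalityI subsetI)
    fix q assume "q \<in> D"
    thus "q \<in> {q. prime q \<and> q dvd \<Prod>D}" using that by auto
  next
    fix q assume q: "q \<in> {q. prime q \<and> q dvd \<Prod>D}"
    have "\<exists>p\<in>D. q dvd p" using prime_dvd_prod_iff[of D q "\<lambda>x. x"] that q by auto
    then obtain p where "p \<in> D" "q dvd p" by blast
    moreover from this have "q = p" using q that by (auto intro: primes_dvd_imp_eq)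
    ultimately show "q \<in> D" by simp
  qed
  show "A = B" using *[OF A] *[OF B] eq by metis
qed

lemma prod_primes_pos:
  assumes "\<And>p. p \<in> D \<Longrightarrow> prime (p::nat)"
  shows "\<Prod>D > 0"
  using assms by (auto intro!: prod_pos simp: prime_gt_0_nat)

text \<open>
  Expanded, the product is a sum of \<open>1/q\<close> over squarefree \<open>z\<close>-smooth \<open>q\<close>. Those with \<open>q \<le> z\<^sup>4\<close> are bounded by
  the harmonic sum. The remaining ones are weighted with \<open>ln q / (4 ln z) \<ge> 1\<close>; since
  \<open>\<Sum> ln q / q\<close> is at most the product times \<open>\<Sum> ln p / p \<le> 2 ln z\<close>, they make up no more than half of the product.
\<close>
lemma prod_one_plus_inverse_prime_le:
  fixes z :: nat
  assumes "z \<ge> 2"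
  shows "(\<Prod>p | prime p \<and> p \<le> z. 1 + 1 / real p) \<le> 2 + 8 * ln (real z)"
proof -
  let ?P = "{p. prime p \<and> p \<le> z}"
  let ?g = "\<lambda>D. \<Prod>p\<in>D. 1 / real p"
  define V where "V = (\<Prod>p\<in>?P. 1 + 1 / real p)"
  have fin: "finite ?P" by simp
  have Veq: "(\<Prod>p\<in>A. 1 + 1 / real p) = (\<Sum>D\<in>Pow A. ?g D)" if "finite A" for A
    using prod_add[OF that, of "\<lambda>p. 1 / real p" "\<lambda>_. 1"] by (simp add: add.commute)
  have z1: "ln (real z) > 0" using assms by simp
  have gprod: "?g D = 1 / real (\<Prod>D)" for D by (simp add: prod_dividef)
  have gnn: "?g D \<ge> 0" for D by (intro prod_nonneg) simp
  \<comment> \<open>With the exponent 4 and the constant 2 for the sum of \<open>ln p / p\<close>, large \<open>q\<close> account for at most half.\<close>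
  let ?Y = "z ^ 4"
  let ?S = "{D\<in>Pow ?P. \<Prod>D \<le> ?Y}" and ?T = "{D\<in>Pow ?P. \<not> \<Prod>D \<le> ?Y}"
  have "V = (\<Sum>D\<in>?S \<union> ?T. ?g D)"
    unfolding V_def Veq[OF fin] by (rule sum.cong) auto
  also have "\<dots> = (\<Sum>D\<in>?S. ?g D) + (\<Sum>D\<in>?T. ?g D)"
    by (rule sum.union_disjoint) auto
  also have "(\<Sum>D\<in>?S. ?g D) \<le> 1 + 4 * ln (real z)"
  proof -
    have "(\<Sum>D\<in>?S. ?g D) = (\<Sum>D\<in>?S. 1 / real (\<Prod>D))" by (simp only: gprod)
    also have "\<dots> = (\<Sum>n\<in>(\<lambda>D. \<Prod>D) ` ?S. 1 / real n)"
      by (subst sum.reindex, rule inj_on_subset[OF inj_on_prod_primes]) (auto intro: finite_subset[OF _ fin])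
    also have "\<dots> \<le> (\<Sum>n\<in>{1..?Y}. 1 / real n)"
    proof (intro sum_mono2)
      show "(\<lambda>D. \<Prod>D) ` ?S \<subseteq> {1..?Y}"
      proof
        fix n assume "n \<in> (\<lambda>D. \<Prod>D) ` ?S"
        then obtain D where D: "D \<in> ?S" "n = \<Prod>D" by blast
        have "\<Prod>D > 0" by (rule prod_primes_pos) (use D in auto)
        thus "n \<in> {1..?Y}" using D by auto
      qed
    qed auto
    also have "\<dots> \<le> 1 + ln (real ?Y)" using assms by (intro sum_inverse_le_ln) simp
    also have "ln (real ?Y) = 4 * ln (real z)" using assms by (simp add: ln_realpow)
    finally show ?thesis .
  qed
  also have "(\<Sum>D\<in>?T. ?g D) \<le> V / 2"
  proof -
    have "(\<Sum>D\<in>?T. ?g D) \<le> (\<Sum>D\<in>?T. ?g D * ((\<Sum>p\<in>D. ln (real p)) / (4 * ln (real z))))"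
    proof (intro sum_mono)
      fix D assume D: "D \<in> ?T"
      have pr: "\<And>p. p \<in> D \<Longrightarrow> prime p" using D by auto
      have "ln (real ?Y) \<le> ln (real (\<Prod>D))"
        using D assms prod_primes_pos[OF pr] by (subst ln_le_cancel_iff) (auto simp del: of_nat_prod of_nat_power)
      also have "ln (real (\<Prod>D)) = ln (\<Prod>p\<in>D. real p)" by simp
      also have "\<dots> = (\<Sum>p\<in>D. ln (real p))"
        using D finite_subset[OF _ fin] pr by (subst ln_prod) (auto simp: prime_gt_0_nat)
      finally have "4 * ln (real z) \<le> (\<Sum>p\<in>D. ln (real p))"
        using assms by (simp add: ln_realpow)
      hence "1 \<le> (\<Sum>p\<in>D. ln (real p)) / (4 * ln (real z))" using z1 by simp
      hence "?g D * 1 \<le> ?g D * ((\<Sum>p\<in>D. ln (real p)) / (4 * ln (real z)))"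
        by (rule mult_left_mono[OF _ gnn])
      thus "?g D \<le> ?g D * ((\<Sum>p\<in>D. ln (real p)) / (4 * ln (real z)))"
        by (simp only: mult_1_right)
    qed
    also have "\<dots> \<le> (\<Sum>D\<in>Pow ?P. ?g D * ((\<Sum>p\<in>D. ln (real p)) / (4 * ln (real z))))"
    proof (intro sum_mono2)
      fix D assume D: "D \<in> Pow ?P - ?T"
      have "(\<Sum>p\<in>D. ln (real p)) \<ge> 0"
      proof (intro sum_nonneg)
        fix p assume "p \<in> D"
        hence "p \<ge> 1" using D prime_ge_1_nat by auto
        thus "ln (real p) \<ge> 0" by simp
      qed
      thus "0 \<le> ?g D * ((\<Sum>p\<in>D. ln (real p)) / (4 * ln (real z)))"
        using z1 gnn by (intro mult_nonneg_nonneg divide_nonneg_pos) auto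
    qed auto
    also have "\<dots> = (\<Sum>D\<in>Pow ?P. \<Sum>p\<in>?P. if p \<in> D then ?g D * ln (real p) else 0) / (4 * ln (real z))"
    proof -
      have "?g D * (\<Sum>p\<in>D. ln (real p)) = (\<Sum>p\<in>?P. if p \<in> D then ?g D * ln (real p) else 0)" if "D \<in> Pow ?P" for D
      proof -
        have "(\<Sum>p\<in>?P. if p \<in> D then ?g D * ln (real p) else 0) = (\<Sum>p\<in>{p\<in>?P. p \<in> D}. ?g D * ln (real p))"
          by (rule sum.inter_filter[symmetric]) simp
        also have "{p\<in>?P. p \<in> D} = D" using that by auto
        finally show ?thesis by (simp add: sum_distrib_left)
      qed
      hence "(\<Sum>D\<in>Pow ?P. ?g D * (\<Sum>p\<in>D. ln (real p))) = (\<Sum>D\<in>Pow ?P. \<Sum>p\<in>?P. if p \<in> D then ?g D * ln (real p) else 0)"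
        by (rule sum.cong[OF refl])
      thus ?thesis by (simp only: times_divide_eq_right sum_divide_distrib[symmetric])
    qed
    also have "(\<Sum>D\<in>Pow ?P. \<Sum>p\<in>?P. if p \<in> D then ?g D * ln (real p) else 0) 
             = (\<Sum>p\<in>?P. \<Sum>D\<in>Pow ?P. if p \<in> D then ?g D * ln (real p) else 0)"
      by (rule sum.swap)
    also have "\<dots> \<le> (\<Sum>p\<in>?P. ln (real p) / real p * V)"
    proof (intro sum_mono)
      fix p assume p: "p \<in> ?P"
      have "(\<Sum>D\<in>Pow ?P. if p \<in> D then ?g D * ln (real p) else 0) = (\<Sum>D\<in>{D\<in>Pow ?P. p \<in> D}. ?g D * ln (real p))"
        by (rule sum.inter_filter[symmetric]) simp
      also have "\<dots> = (\<Sum>D\<in>Pow (?P - {p}). ?g (insert p D) * ln (real p))"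
        using p by (intro sum.reindex_bij_witness[of _ "\<lambda>D. insert p D" "\<lambda>D. D - {p}"]) (auto simp: insert_absorb)
      also have "\<dots> = (\<Sum>D\<in>Pow (?P - {p}). ln (real p) / real p * ?g D)"
      proof (intro sum.cong refl)
        fix D assume "D \<in> Pow (?P - {p})"
        hence "finite D" "p \<notin> D" using finite_subset[OF _ fin] by auto
        thus "?g (insert p D) * ln (real p) = ln (real p) / real p * ?g D" by simp
      qed
      also have "\<dots> = ln (real p) / real p * (\<Sum>D\<in>Pow (?P - {p}). ?g D)"
        by (simp add: sum_distrib_left)
      also have "\<dots> \<le> ln (real p) / real p * (\<Sum>D\<in>Pow ?P. ?g D)"
        using p by (intro mult_left_mono sum_mono2) (auto intro!: prod_nonneg divide_nonneg_nonneg ln_ge_zero dest: prime_ge_1_nat)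
      finally show "(\<Sum>D\<in>Pow ?P. if p \<in> D then ?g D * ln (real p) else 0) \<le> ln (real p) / real p * V"
        by (simp only: V_def Veq[OF fin])
    qed
    also have "\<dots> = (\<Sum>p\<in>?P. ln (real p) / real p) * V" by (simp add: sum_distrib_right)
    also have "\<dots> \<le> 2 * ln (real z) * V"
      using sum_ln_prime_over_prime_le[of z] assms unfolding V_def by (intro mult_right_mono prod_nonneg) auto
    finally show ?thesis using z1 by (simp add: divide_right_mono field_simps)
  qed
  finally show ?thesis unfolding V_def by simp
qed

definition euler_factor :: "nat \<Rightarrow> real" where
  "euler_factor z = (\<Prod>p | prime p \<and> p \<le> z. 1 / (1 - 1 / real p))"

lemma euler_factor_nonneg: "euler_factor z \<ge> 0"
  unfolding euler_factor_def
proof (intro prod_nonneg ballI)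
  fix p :: nat assume "p \<in> {p. prime p \<and> p \<le> z}"
  hence "real p \<ge> 1" using prime_ge_1_nat by auto
  thus "0 \<le> 1 / (1 - 1 / real p)" by simp
qed

text \<open>
  A telescoping product: \<open>1 - 1/n\<^sup>2 = (n - 1)(n + 1)/n\<^sup>2\<close>.
\<close>
lemma prod_one_minus_inverse_square_eq:
  fixes z :: nat
  assumes "z \<ge> 1"
  shows "(\<Prod>n\<in>{2..z}. 1 / (1 - 1 / (real n)\<^sup>2)) = 2 * real z / (real z + 1)"
  using assms
proof (induction z rule: dec_induct)
  case (step z)
  have "{2..Suc z} = insert (Suc z) {2..z}" using step by auto
  hence "(\<Prod>n\<in>{2..Suc z}. 1 / (1 - 1 / (real n)\<^sup>2))
         = 1 / (1 - 1 / (real (Suc z))\<^sup>2) * (2 * real z / (real z + 1))"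
    using step by simp
  also have "\<dots> = 2 * real (Suc z) / (real (Suc z) + 1)"
  proof -
    have "1 - 1 / (real z + 1)\<^sup>2 = real z * (real z + 2) / (real z + 1)\<^sup>2"
    proof -
      have "real z * (real z + 2) = (real z + 1)\<^sup>2 - 1" by (simp add: algebra_simps power2_eq_square)
      moreover have "(real z + 1)\<^sup>2 \<noteq> 0" by simp
      ultimately show ?thesis by (simp add: diff_divide_distrib)
    qed
    hence "1 / (1 - 1 / (real z + 1)\<^sup>2) = (real z + 1)\<^sup>2 / (real z * (real z + 2))"
      by simp
    moreover have "(real z + 1)\<^sup>2 / (real z * (real z + 2)) * (2 * real z / (real z + 1))
        = 2 * (real z + 1) / (real z + 2)"
      using step by (simp add: divide_simps power2_eq_square)
    ultimately show ?thesis by (simp add: add_ac)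
  qed
  finally show ?case .
qed simp

lemma euler_factor_le:
  assumes "z \<ge> 2"
  shows "euler_factor z \<le> 4 + 16 * ln (real z)"
proof -
  let ?P = "{p. prime p \<and> p \<le> z}"
  have "euler_factor z = (\<Prod>p\<in>?P. (1 / (1 - 1 / (real p)\<^sup>2)) * (1 + 1 / real p))"
    unfolding euler_factor_def
  proof (intro prod.cong refl)
    fix p assume "p \<in> ?P"
    hence p: "real p > 1" using prime_gt_1_nat by auto
    hence "(real p)\<^sup>2 > 1" by (simp add: one_less_power)
    with p show "1 / (1 - 1 / real p) = (1 / (1 - 1 / (real p)\<^sup>2)) * (1 + 1 / real p)"
      by (simp add: divide_simps power2_eq_square) (simp add: algebra_simps)
  qed
  also have "\<dots> = (\<Prod>p\<in>?P. 1 / (1 - 1 / (real p)\<^sup>2)) * (\<Prod>p\<in>?P. 1 + 1 / real p)"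
    by (rule prod.distrib)
  also have "\<dots> \<le> 2 * (2 + 8 * ln (real z))"
  proof (intro mult_mono prod_one_plus_inverse_prime_le assms)
    have "(\<Prod>p\<in>?P. 1 / (1 - 1 / (real p)\<^sup>2)) \<le> (\<Prod>n\<in>{2..z}. 1 / (1 - 1 / (real n)\<^sup>2))"
    proof (intro prod_mono2)
      fix n assume "n \<in> {2..z} - ?P"
      hence "real n \<ge> 2" by auto
      hence "(real n)\<^sup>2 > 1" by (simp add: one_less_power)
      hence "0 \<le> 1 / (real n)\<^sup>2" "1 / (real n)\<^sup>2 < 1" using \<open>real n \<ge> 2\<close> by (auto simp: divide_less_eq_1)
      thus "1 \<le> 1 / (1 - 1 / (real n)\<^sup>2)" by (subst le_divide_eq_1_pos) linarith+
    next
      fix n assume "n \<in> ?P"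
      hence "real n > 1" using prime_gt_1_nat by auto
      hence "(real n)\<^sup>2 > 1" by (simp add: one_less_power)
      thus "0 \<le> 1 / (1 - 1 / (real n)\<^sup>2)" using \<open>real n > 1\<close> by (auto simp: divide_le_eq_1)
    qed (auto simp: prime_ge_2_nat)
    also have "\<dots> \<le> 2" using assms by (subst prod_one_minus_inverse_square_eq) (auto simp: field_simps)
    finally show "(\<Prod>p\<in>?P. 1 / (1 - 1 / (real p)\<^sup>2)) \<le> 2" .
  qed (auto intro: prod_nonneg)
  finally show ?thesis by simp
qed

lemma euler_factor_1: "euler_factor 1 = 1"
proof -
  have "{p. prime p \<and> p \<le> (1::nat)} = {}" by (auto dest: prime_gt_1_nat)
  thus ?thesis unfolding euler_factor_def by (metis prod.empty)
qed

section \<open>Sieve mass: a lower bound for the sum of 1/phi over rough moduli\<close>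

text \<open>
  The sum of \<open>1/\<phi>(q)\<close> over squarefree \<open>q \<le> x\<close> with prime factors in \<open>P\<close>; the set \<open>D\<close> of prime factors
  stands for \<open>q\<close>. This is the denominator in Selberg's upper bound sieve.
\<close>
definition sieve_mass :: "nat set \<Rightarrow> nat \<Rightarrow> real" where
  "sieve_mass P x = (\<Sum>D | D \<subseteq> P \<and> \<Prod>D \<le> x. \<Prod>p\<in>D. 1 / (real p - 1))"

definition smooth_sum :: "nat set \<Rightarrow> nat \<Rightarrow> real" where
  "smooth_sum P x = (\<Sum>n | n \<in> {1..x} \<and> prime_factors n \<subseteq> P. 1 / real n)"

lemma sieve_mass_nonneg:
  assumes "\<And>p. p \<in> P \<Longrightarrow> prime p"
  shows "sieve_mass P x \<ge> 0"
  unfolding sieve_mass_def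
proof (intro sum_nonneg prod_nonneg ballI)
  fix D p assume "D \<in> {D. D \<subseteq> P \<and> \<Prod>D \<le> x}" "p \<in> D"
  hence "p \<ge> 1" using assms prime_ge_1_nat by blast
  thus "0 \<le> 1 / (real p - 1)" by simp
qed

lemma sieve_mass_mono:
  assumes "finite P" "\<And>p. p \<in> P \<Longrightarrow> prime p" "x \<le> y"
  shows "sieve_mass P x \<le> sieve_mass P y"
  unfolding sieve_mass_def
proof (intro sum_mono2 prod_nonneg ballI)
  fix D p assume "D \<in> {D. D \<subseteq> P \<and> \<Prod>D \<le> y} - {D. D \<subseteq> P \<and> \<Prod>D \<le> x}" "p \<in> D"
  hence "p \<ge> 1" using assms prime_ge_1_nat by blast
  thus "0 \<le> 1 / (real p - 1)" by simp
qed (use assms in auto)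

lemma smooth_sum_mono: "x \<le> y \<Longrightarrow> smooth_sum P x \<le> smooth_sum P y"
  unfolding smooth_sum_def by (intro sum_mono2) auto

lemma smooth_sum_insert:
  assumes "prime p" "p \<notin> P"
  shows "smooth_sum (insert p P) x = smooth_sum P x + smooth_sum (insert p P) (x div p) / real p"
proof -
  have p0: "p > 0" using assms prime_gt_0_nat by auto
  let ?A = "{n. n \<in> {1..x} \<and> prime_factors n \<subseteq> P}"
  let ?K = "{k. k \<in> {1..x div p} \<and> prime_factors k \<subseteq> insert p P}"
  have eq: "{n. n \<in> {1..x} \<and> prime_factors n \<subseteq> insert p P} = ?A \<union> (\<lambda>k. p * k) ` ?K"
  proof (intro equalityI subsetI)
    fix n assume n: "n \<in> {n. n \<in> {1..x} \<and> prime_factors n \<subseteq> insert p P}"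
    show "n \<in> ?A \<union> (\<lambda>k. p * k) ` ?K"
    proof (cases "p dvd n")
      case True
      then obtain k where k: "n = p * k" by auto
      have "prime_factors k \<subseteq> prime_factors n" using n k by (intro dvd_prime_factors) auto
      moreover have "k \<le> x div p" using n k p0 by (simp add: less_eq_div_iff_mult_less_eq mult.commute)
      ultimately have "k \<in> ?K" using n k by auto
      thus ?thesis using k by blast
    next
      case False
      hence "p \<notin> prime_factors n" by auto
      thus ?thesis using n by auto
    qed
  next
    fix n assume "n \<in> ?A \<union> (\<lambda>k. p * k) ` ?K"
    thus "n \<in> {n. n \<in> {1..x} \<and> prime_factors n \<subseteq> insert p P}"
    proof
      assume "n \<in> (\<lambda>k. p * k) ` ?K"
      then obtain k where k: "n = p * k" "k \<in> ?K" by blast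
      have "prime_factors n = insert p (prime_factors k)"
        using k p0 assms by (auto simp: prime_factorization_mult prime_factorization_prime)
      moreover have "n \<le> x" using k p0 by (simp add: less_eq_div_iff_mult_less_eq mult.commute)
      ultimately show ?thesis using k p0 by auto
    qed auto
  qed
  have "p \<in> prime_factors (p * k)" if "k \<in> ?K" for k
    using that assms p0 by (intro prime_factorsI) auto
  hence disj: "?A \<inter> (\<lambda>k. p * k) ` ?K = {}" using assms by auto
  have "smooth_sum (insert p P) x = smooth_sum P x + (\<Sum>n\<in>(\<lambda>k. p * k) ` ?K. 1 / real n)"
    unfolding smooth_sum_def eq by (rule sum.union_disjoint) (use disj in auto)
  also have "(\<Sum>n\<in>(\<lambda>k. p * k) ` ?K. 1 / real n) = (\<Sum>k\<in>?K. 1 / real (p * k))"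
    by (subst sum.reindex) (use p0 in \<open>auto simp: inj_on_def\<close>)
  also have "\<dots> = smooth_sum (insert p P) (x div p) / real p"
    unfolding smooth_sum_def by (simp add: sum_divide_distrib mult.commute)
  finally show ?thesis .
qed

lemma sieve_mass_insert:
  assumes "finite P" "p > 0" "p \<notin> P"
  shows "sieve_mass (insert p P) x = sieve_mass P x + sieve_mass P (x div p) / (real p - 1)"
proof -
  let ?A = "{D. D \<subseteq> P \<and> \<Prod>D \<le> x}"
  let ?K = "{D. D \<subseteq> P \<and> \<Prod>D \<le> x div p}"
  have ins: "\<Prod>(insert p D) = p * \<Prod>D" "p \<notin> D" "finite D" if "D \<subseteq> P" for D
  proof -
    show "p \<notin> D" "finite D" using that assms finite_subset[of D P] by auto
    thus "\<Prod>(insert p D) = p * \<Prod>D" by simp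
  qed
  have eq: "{D. D \<subseteq> insert p P \<and> \<Prod>D \<le> x} = ?A \<union> insert p ` ?K"
  proof (intro equalityI subsetI)
    fix D assume D: "D \<in> {D. D \<subseteq> insert p P \<and> \<Prod>D \<le> x}"
    show "D \<in> ?A \<union> insert p ` ?K"
    proof (cases "p \<in> D")
      case True
      have sub: "D - {p} \<subseteq> P" using D by auto
      have "insert p (D - {p}) = D" using True by auto
      hence "p * \<Prod>(D - {p}) \<le> x" using ins(1)[OF sub] D by auto
      hence "D - {p} \<in> ?K" using sub assms
        by (auto simp: less_eq_div_iff_mult_less_eq mult.commute)
      moreover have "D = insert p (D - {p})" using True by auto
      ultimately show ?thesis by blast
    qed (use D in auto)
  next
    fix D assume "D \<in> ?A \<union> insert p ` ?K"
    thus "D \<in> {D. D \<subseteq> insert p P \<and> \<Prod>D \<le> x}"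
    proof
      assume "D \<in> insert p ` ?K"
      then obtain C where "D = insert p C" "C \<in> ?K" by blast
      thus ?thesis using ins(1)[of C] assms by (auto simp: less_eq_div_iff_mult_less_eq mult.commute)
    qed auto
  qed
  have "sieve_mass (insert p P) x = sieve_mass P x + (\<Sum>D\<in>insert p ` ?K. \<Prod>p\<in>D. 1 / (real p - 1))"
    unfolding sieve_mass_def eq by (rule sum.union_disjoint) (use assms in auto)
  also have "(\<Sum>D\<in>insert p ` ?K. \<Prod>p\<in>D. 1 / (real p - 1)) = (\<Sum>D\<in>?K. \<Prod>p\<in>insert p D. 1 / (real p - 1))"
    by (subst sum.reindex) (use assms in \<open>auto simp: inj_on_def\<close>)
  also have "\<dots> = (\<Sum>D\<in>?K. (\<Prod>p\<in>D. 1 / (real p - 1)) / (real p - 1))"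
    using ins by (intro sum.cong refl) auto
  also have "\<dots> = sieve_mass P (x div p) / (real p - 1)"
    unfolding sieve_mass_def by (simp add: sum_divide_distrib)
  finally show ?thesis .
qed

text \<open>
  This holds because \<open>1/\<phi>(q)\<close> is the sum of \<open>1/n\<close> over all \<open>n\<close> with the same prime factors as \<open>q\<close>. The
  recurrences in \<open>p\<close> encode this without infinite series.
\<close>
lemma smooth_sum_le_sieve_mass:
  assumes "finite P" "\<And>p. p \<in> P \<Longrightarrow> prime p"
  shows "smooth_sum P x \<le> sieve_mass P x"
  using assms
proof (induction P arbitrary: x rule: finite_induct)
  case empty
  have "{n. n \<in> {1..x} \<and> prime_factors n \<subseteq> {}} = (if 1 \<le> x then {1} else {})"
    by (auto simp: prime_factorization_empty_iff)
  moreover have "{D. D \<subseteq> {} \<and> \<Prod>D \<le> x} = (if 1 \<le> x then {{}} else {})" by auto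
  ultimately show ?case unfolding smooth_sum_def sieve_mass_def by simp
next
  case (insert p P x)
  have p: "prime p" "real p > 1" "p > 1" using insert.prems prime_gt_1_nat by auto
  have IH: "smooth_sum P y \<le> sieve_mass P y" for y using insert by auto
  show ?case
  proof (induction x rule: less_induct)
    case (less x)
    show ?case
    proof (cases "x = 0")
      case True
      thus ?thesis using sieve_mass_nonneg[of "insert p P" x] insert.prems by (simp add: smooth_sum_def)
    next
      case False
      hence "x div p < x" using p by simp
      hence "smooth_sum (insert p P) (x div p) \<le> sieve_mass (insert p P) (x div p)" by (rule less)
      also have "\<dots> = sieve_mass P (x div p) + sieve_mass P (x div p div p) / (real p - 1)"
        using insert p by (intro sieve_mass_insert) auto
      also have "sieve_mass P (x div p div p) \<le> sieve_mass P (x div p)"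
        using insert.prems by (intro sieve_mass_mono insert.hyps) auto
      hence "sieve_mass P (x div p) + sieve_mass P (x div p div p) / (real p - 1)
             \<le> sieve_mass P (x div p) + sieve_mass P (x div p) / (real p - 1)"
        using p by (intro add_left_mono divide_right_mono) auto
      also have "\<dots> = real p * (sieve_mass P (x div p) / (real p - 1))"
        using p by (simp add: field_simps)
      finally have *: "smooth_sum (insert p P) (x div p) / real p \<le> sieve_mass P (x div p) / (real p - 1)"
        using p by (simp add: pos_divide_le_eq mult.commute)
      have "smooth_sum (insert p P) x = smooth_sum P x + smooth_sum (insert p P) (x div p) / real p"
        using p insert by (intro smooth_sum_insert) auto
      also have "\<dots> \<le> sieve_mass P x + sieve_mass P (x div p) / (real p - 1)"
        using * IH by (intro add_mono)
      also have "\<dots> = sieve_mass (insert p P) x"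
        using insert p by (intro sieve_mass_insert[symmetric]) auto
      finally show ?thesis .
    qed
  qed
qed

lemma smooth_sum_union_le:
  assumes "finite A" "\<And>p. p \<in> A \<Longrightarrow> prime p" "A \<inter> P = {}"
  shows "smooth_sum (A \<union> P) x \<le> (\<Prod>p\<in>A. 1 / (1 - 1 / real p)) * smooth_sum P x"
  using assms
proof (induction A rule: finite_induct)
  case (insert p A)
  have p: "prime p" "real p > 1" using insert.prems prime_gt_1_nat by auto
  let ?B = "A \<union> P"
  have "smooth_sum (insert p ?B) x = smooth_sum ?B x + smooth_sum (insert p ?B) (x div p) / real p"
    using p insert by (intro smooth_sum_insert) auto
  also have "\<dots> \<le> smooth_sum ?B x + smooth_sum (insert p ?B) x / real p"
    using p by (intro add_left_mono divide_right_mono smooth_sum_mono) auto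
  finally have "smooth_sum (insert p ?B) x * (1 - 1 / real p) \<le> smooth_sum ?B x"
    by (simp add: algebra_simps)
  moreover have "1 - 1 / real p > 0" using p by simp
  ultimately have "smooth_sum (insert p ?B) x \<le> 1 / (1 - 1 / real p) * smooth_sum ?B x"
    by (simp add: pos_le_divide_eq)
  also have "\<dots> \<le> 1 / (1 - 1 / real p) * ((\<Prod>p\<in>A. 1 / (1 - 1 / real p)) * smooth_sum P x)"
    using insert \<open>1 - 1 / real p > 0\<close> by (intro mult_left_mono) auto
  finally show ?case using insert by (simp add: mult.assoc)
qed simp

text \<open>
  Restricting the sieve to primes greater than \<open>z\<close> costs at most the Euler factor of the primes up to
  \<open>z\<close>, so the sieve mass is still at least a constant times \<open>ln Q / ln z\<close>.
\<close>
lemma ln_le_euler_factor_mult_sieve_mass: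
  fixes z Q :: nat
  shows "ln (real Q + 1) \<le> euler_factor z * sieve_mass {p. prime p \<and> z < p \<and> p \<le> Q} Q"
proof -
  let ?A = "{p::nat. prime p \<and> p \<le> z}" and ?P = "{p. prime p \<and> z < p \<and> p \<le> Q}"
  have "ln (real Q + 1) \<le> harm Q" by (rule ln_le_harm)
  also have "harm Q = smooth_sum (?A \<union> ?P) Q"
    unfolding harm_def smooth_sum_def
  proof (rule sum.cong)
    show "{1..Q} = {n. n \<in> {1..Q} \<and> prime_factors n \<subseteq> ?A \<union> ?P}"
    proof -
      have "p \<in> ?A \<union> ?P" if "n \<in> {1..Q}" "p \<in> prime_factors n" for n p
      proof -
        have "prime p" "p dvd n" using that by auto
        moreover have "p \<le> n" using that \<open>p dvd n\<close> by (intro dvd_imp_le) auto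
        ultimately show ?thesis using that by auto
      qed
      thus ?thesis by blast
    qed
  qed (simp add: field_simps)
  also have "\<dots> \<le> euler_factor z * smooth_sum ?P Q"
    unfolding euler_factor_def by (rule smooth_sum_union_le) auto
  also have "\<dots> \<le> euler_factor z * sieve_mass ?P Q"
    using euler_factor_nonneg by (intro mult_left_mono smooth_sum_le_sieve_mass) auto
  finally show ?thesis .
qed

section \<open>Additive characters and the rational shifts of the Selberg sieve\<close>

lemma e_add: "e (x + y) = e x * e y"
  by (simp add: e_def distrib_left exp_add)

lemma e_0 [simp]: "e 0 = 1"
  by (simp add: e_def)

lemma norm_e [simp]: "norm (e x) = 1"
  by (simp add: e_def)

lemma e_minus: "e (- x) = cnj (e x)"
  by (simp add: e_def exp_cnj)

lemma e_of_int [simp]: "e (of_int k) = 1"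
  unfolding e_def using exp_integer_2pi[of "of_int k"] by (simp add: mult_ac)

lemma e_of_nat [simp]: "e (real k) = 1"
  using e_of_int[of "int k"] by simp

lemma e_eq_1_imp_Ints:
  assumes "e x = 1"
  shows "x \<in> \<int>"
proof -
  from assms obtain k :: int where "Im (2 * \<i> * of_real pi * of_real x) = of_int (2 * k) * pi"
    unfolding e_def exp_eq_1 by blast
  hence "x = of_int k" by simp
  thus ?thesis by simp
qed

lemma e_sum: "e (\<Sum>i\<in>A. f i) = (\<Prod>i\<in>A. e (f i))"
  by (induction A rule: infinite_finite_induct) (simp_all add: e_add)

lemma e_power: "e x ^ k = e (real k * x)"
  by (induction k) (simp_all add: e_add[symmetric] algebra_simps)

lemma sum_e_geometric:
  fixes x :: real
  assumes "m > 0" and "x \<notin> \<int>" and "real m * x \<in> \<int>"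
  shows "(\<Sum>k<m. e (real k * x)) = 0"
proof -
  have "e x \<noteq> 1" using assms e_eq_1_imp_Ints by blast
  moreover have "e x ^ m = 1" using assms(3) by (auto simp: e_power elim!: Ints_cases)
  moreover have "(\<Sum>k<m. e (real k * x)) = (\<Sum>k<m. e x ^ k)" by (simp add: e_power)
  ultimately show ?thesis by (simp add: geometric_sum)
qed

text \<open>
  A fraction \<open>a/q\<close> modulo 1 with squarefree denominator is determined by its partial fraction
  decomposition \<open>\<Sum> a\<^sub>p / p\<close>. An element \<open>a\<close> of \<open>shifts P Q\<close> is the family of the numerators \<open>a\<^sub>p\<close>, and the primes
  with \<open>a\<^sub>p \<noteq> 0\<close> multiply to the denominator \<open>q \<le> Q\<close>. In this form sums over fractions factor over the
  primes.
\<close>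
definition shifts :: "nat set \<Rightarrow> nat \<Rightarrow> (nat \<Rightarrow> nat) set" where
  "shifts P Q = {a \<in> PiE P (\<lambda>p. {..<p}). \<Prod>{p\<in>P. a p \<noteq> 0} \<le> Q}"

text \<open>
  The value \<open>\<mu>(q)/\<phi>(q)\<close> at the denominator \<open>q\<close> of the fraction.
\<close>
definition weight :: "nat set \<Rightarrow> (nat \<Rightarrow> nat) \<Rightarrow> real" where
  "weight P a = (\<Prod>p\<in>P. if a p = 0 then 1 else - 1 / (real p - 1))"

text \<open>
  The fraction times \<open>m\<close>, exact when the primes in \<open>P\<close> divide \<open>m\<close>.
\<close>
definition offset :: "nat \<Rightarrow> nat set \<Rightarrow> (nat \<Rightarrow> nat) \<Rightarrow> nat" where
  "offset m P a = (\<Sum>p\<in>P. a p * (m div p))"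

lemma finite_shifts: "finite P \<Longrightarrow> finite (shifts P Q)"
  unfolding shifts_def by (auto intro!: finite_PiE)

lemma sum_shifts_prod:
  fixes f :: "nat \<Rightarrow> nat \<Rightarrow> 'c :: comm_semiring_1"
  assumes "finite P" "\<And>p. p \<in> P \<Longrightarrow> prime p" and f0: "\<And>p. p \<in> P \<Longrightarrow> f p 0 = 1"
  shows "(\<Sum>a\<in>shifts P Q. \<Prod>p\<in>P. f p (a p)) = (\<Sum>D | D \<subseteq> P \<and> \<Prod>D \<le> Q. \<Prod>p\<in>D. \<Sum>c\<in>{1..<p}. f p c)"
proof -
  let ?B = "\<lambda>D p. if p \<in> D then {1..<p} else {0::nat}"
  have *: "(\<Prod>p\<in>D. \<Sum>c\<in>{1..<p}. f p c) = (\<Sum>a\<in>PiE P (?B D). \<Prod>p\<in>P. f p (a p))" if "D \<subseteq> P" for D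
  proof -
    have "(\<Sum>a\<in>PiE P (?B D). \<Prod>p\<in>P. f p (a p)) = (\<Prod>p\<in>P. \<Sum>c\<in>?B D p. f p c)"
      by (subst prod_sum_PiE) (use assms in auto)
    also have "\<dots> = (\<Prod>p\<in>D. \<Sum>c\<in>?B D p. f p c)"
      by (rule prod.mono_neutral_right) (use that assms in auto)
    finally show ?thesis by simp
  qed
  have p0: "p > 0" if "p \<in> P" for p using assms that prime_gt_0_nat by auto
  let ?DD = "{D. D \<subseteq> P \<and> \<Prod>D \<le> Q}"
  have fin: "finite ?DD" using assms by simp
  have supp: "{p\<in>P. a p \<noteq> 0} = D" if "D \<subseteq> P" "a \<in> PiE P (?B D)" for a D
  proof -
    have mem: "a p \<in> ?B D p" if "p \<in> P" for p using \<open>a \<in> PiE P (?B D)\<close> that by (rule PiE_mem)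
    have "a p \<noteq> 0 \<longleftrightarrow> p \<in> D" if "p \<in> P" for p
      using mem[OF that] by (cases "p \<in> D") simp_all
    thus ?thesis using \<open>D \<subseteq> P\<close> by auto
  qed
  have "(\<Sum>D\<in>?DD. \<Prod>p\<in>D. \<Sum>c\<in>{1..<p}. f p c) = (\<Sum>D\<in>?DD. \<Sum>a\<in>PiE P (?B D). \<Prod>p\<in>P. f p (a p))"
    by (rule sum.cong) (use * in auto)
  also have "\<dots> = (\<Sum>(D, a)\<in>Sigma ?DD (\<lambda>D. PiE P (?B D)). \<Prod>p\<in>P. f p (a p))"
    using fin assms by (subst sum.Sigma) (auto intro!: finite_PiE)
  also have "\<dots> = (\<Sum>a\<in>shifts P Q. \<Prod>p\<in>P. f p (a p))"
  proof (rule sum.reindex_bij_witness[of _ "\<lambda>a. ({p\<in>P. a p \<noteq> 0}, a)" snd])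
    fix x assume "x \<in> Sigma ?DD (\<lambda>D. PiE P (?B D))"
    then obtain D a where x: "x = (D, a)" "D \<subseteq> P" "\<Prod>D \<le> Q" "a \<in> PiE P (?B D)" by auto
    have s: "{p\<in>P. a p \<noteq> 0} = D" by (rule supp) fact+
    show "({p\<in>P. snd x p \<noteq> 0}, snd x) = x" using s x by simp
    have "a \<in> PiE P (\<lambda>p. {..<p})"
    proof (rule PiE_I)
      fix p assume "p \<in> P"
      thus "a p \<in> {..<p}" using PiE_mem[OF x(4), of p] p0 by (auto split: if_splits)
    qed (rule PiE_arb[OF x(4)])
    thus "snd x \<in> shifts P Q" unfolding shifts_def using s x by simp
  next
    fix a assume a: "a \<in> shifts P Q"
    have aP: "a \<in> PiE P (\<lambda>p. {..<p})" using a unfolding shifts_def by simp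
    have "a \<in> PiE P (?B {p\<in>P. a p \<noteq> 0})"
    proof (rule PiE_I)
      fix p assume p: "p \<in> P"
      show "a p \<in> ?B {p\<in>P. a p \<noteq> 0} p" using PiE_mem[OF aP p] p by simp
    qed (rule PiE_arb[OF aP])
    thus "({p\<in>P. a p \<noteq> 0}, a) \<in> Sigma ?DD (\<lambda>D. PiE P (?B D))"
      using a unfolding shifts_def by auto
  qed auto
  finally show ?thesis by simp
qed

lemma offset_over_modulus:
  assumes "\<And>p. p \<in> P \<Longrightarrow> p > 0" "m > 0" "\<And>p. p \<in> P \<Longrightarrow> p dvd m"
  shows "real (offset m P a) / real m = (\<Sum>p\<in>P. real (a p) / real p)"
  unfolding offset_def of_nat_sum sum_divide_distrib
proof (rule sum.cong[OF refl])
  fix p assume "p \<in> P"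
  hence "real (m div p) = real m / real p" using assms by (simp add: real_of_nat_div)
  thus "real (a p * (m div p)) / real m = real (a p) / real p" using assms by simp
qed

lemma sum_weight_square:
  assumes "finite P" "\<And>p. p \<in> P \<Longrightarrow> prime p"
  shows "(\<Sum>a\<in>shifts P Q. (weight P a)\<^sup>2) = sieve_mass P Q"
proof -
  have "(\<Sum>a\<in>shifts P Q. (weight P a)\<^sup>2)
        = (\<Sum>a\<in>shifts P Q. \<Prod>p\<in>P. if a p = 0 then 1 else (1 / (real p - 1))\<^sup>2)"
    unfolding weight_def prod_power_distrib by (intro sum.cong prod.cong refl) (auto simp: power_divide)
  also have "\<dots> = (\<Sum>D | D \<subseteq> P \<and> \<Prod>D \<le> Q. \<Prod>p\<in>D. \<Sum>c\<in>{1..<p}. if c = 0 then 1 else (1 / (real p - 1))\<^sup>2)"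
    by (rule sum_shifts_prod) (use assms in auto)
  also have "\<dots> = sieve_mass P Q"
    unfolding sieve_mass_def
  proof (intro sum.cong prod.cong refl)
    fix D p assume "D \<in> {D. D \<subseteq> P \<and> \<Prod>D \<le> Q}" "p \<in> D"
    hence p: "p > 1" using assms prime_gt_1_nat by blast
    have "(\<Sum>c\<in>{1..<p}. if c = 0 then 1 else (1 / (real p - 1))\<^sup>2) = (\<Sum>c\<in>{1..<p}. (1 / (real p - 1))\<^sup>2)"
      by (rule sum.cong) auto
    also have "\<dots> = 1 / (real p - 1)" using p by (simp add: of_nat_diff power2_eq_square)
    finally show "(\<Sum>c\<in>{1..<p}. if c = 0 then 1 else (1 / (real p - 1))\<^sup>2) = 1 / (real p - 1)" .
  qed
  finally show ?thesis .
qed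

text \<open>
  The Ramanujan sum identity \<open>\<Sum> \<mu>(q)/\<phi>(q) c\<^sub>q(n) = \<Sum> \<mu>(q)\<^sup>2/\<phi>(q)\<close> for \<open>n\<close> coprime to all \<open>q\<close>: the
  nontrivial residues modulo a prime \<open>p\<close> contribute \<open>-1/(p - 1)\<close> times the character sum \<open>-1\<close>.
\<close>
lemma sum_weight_character:
  assumes "finite P" "\<And>p. p \<in> P \<Longrightarrow> prime p" "m > 0" "\<And>p. p \<in> P \<Longrightarrow> p dvd m"
    and "\<And>p. p \<in> P \<Longrightarrow> \<not> p dvd n"
  shows "(\<Sum>a\<in>shifts P Q. of_real (weight P a) * e (real n * real (offset m P a) / real m))
         = of_real (sieve_mass P Q)"
proof -
  have p1: "p > 1" if "p \<in> P" for p using assms that prime_gt_1_nat by auto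
  have p0: "p > 0" if "p \<in> P" for p using p1[OF that] by simp
  have "(\<Sum>a\<in>shifts P Q. of_real (weight P a) * e (real n * real (offset m P a) / real m))
     = (\<Sum>a\<in>shifts P Q. \<Prod>p\<in>P. (if a p = 0 then 1 else - 1 / (of_nat p - 1)) * e (real (a p) * (real n / real p)))"
  proof (intro sum.cong refl)
    fix a
    have "real n * (real (offset m P a) / real m) = (\<Sum>p\<in>P. real (a p) * (real n / real p))"
      using assms p0 by (subst offset_over_modulus) (auto simp: sum_distrib_left mult_ac)
    hence "real n * real (offset m P a) / real m = (\<Sum>p\<in>P. real (a p) * (real n / real p))"
      by (simp only: times_divide_eq_right)
    hence "e (real n * real (offset m P a) / real m) = (\<Prod>p\<in>P. e (real (a p) * (real n / real p)))"
      by (simp only: e_sum)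
    moreover have "(of_real (weight P a) :: complex) = (\<Prod>p\<in>P. (if a p = 0 then 1 else - 1 / (of_nat p - 1)))"
      unfolding weight_def by (simp only: of_real_prod) (intro prod.cong, auto)
    ultimately show "of_real (weight P a) * e (real n * real (offset m P a) / real m)
      = (\<Prod>p\<in>P. (if a p = 0 then 1 else - 1 / (of_nat p - 1)) * e (real (a p) * (real n / real p)))"
      by (simp only: prod.distrib)
  qed
  also have "\<dots> = (\<Sum>D | D \<subseteq> P \<and> \<Prod>D \<le> Q. \<Prod>p\<in>D. \<Sum>c\<in>{1..<p}. (if c = 0 then 1 else - 1 / (of_nat p - 1)) * e (real c * (real n / real p)))"
    by (rule sum_shifts_prod[where f = "\<lambda>p c. (if c = 0 then 1 else - 1 / (of_nat p - 1)) * e (real c * (real n / real p))"]) (use assms in auto)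
  also have "\<dots> = (\<Sum>D | D \<subseteq> P \<and> \<Prod>D \<le> Q. \<Prod>p\<in>D. of_real (1 / (real p - 1)))"
  proof (intro sum.cong prod.cong refl)
    fix D p assume "D \<in> {D. D \<subseteq> P \<and> \<Prod>D \<le> Q}" "p \<in> D"
    hence pP: "p \<in> P" by auto
    have p: "p > 1" using p1[OF pP] .
    have "(\<Sum>c<p. e (real c * (real n / real p))) = 0"
    proof (rule sum_e_geometric)
      show "real n / real p \<notin> \<int>"
      proof
        assume "real n / real p \<in> \<int>"
        then obtain k where "real n / real p = of_int k" by (elim Ints_cases)
        hence "real n = of_int k * real p" using p by (simp add: field_simps)
        hence "real_of_int (int n) = real_of_int (k * int p)" by simp
        hence "int n = k * int p" by (simp only: of_int_eq_iff)
        hence "int p dvd int n" by simp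
        thus False using assms pP by simp
      qed
      show "real p * (real n / real p) \<in> \<int>" using p by simp
    qed (use p in auto)
    also have "{..<p} = insert 0 {1..<p}" using p by auto
    finally have "1 + (\<Sum>c\<in>{1..<p}. e (real c * (real n / real p))) = 0" by simp
    hence g: "(\<Sum>c\<in>{1..<p}. e (real c * (real n / real p))) = - 1"
      by (simp only: add_eq_0_iff)
    have "(\<Sum>c\<in>{1..<p}. (if c = 0 then 1 else - 1 / (of_nat p - 1)) * e (real c * (real n / real p)))
       = (\<Sum>c\<in>{1..<p}. (- 1 / (of_nat p - 1)) * e (real c * (real n / real p)))"
      by (rule sum.cong) auto
    also have "\<dots> = - 1 / (of_nat p - 1) * (\<Sum>c\<in>{1..<p}. e (real c * (real n / real p)))"
      by (rule sum_distrib_left[symmetric])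
    also have "\<dots> = of_real (1 / (real p - 1))" unfolding g by simp
    finally show "(\<Sum>c\<in>{1..<p}. (if c = 0 then 1 else - 1 / (of_nat p - 1)) * e (real c * (real n / real p))) = of_real (1 / (real p - 1))" .
  qed
  also have "\<dots> = of_real (sieve_mass P Q)"
    unfolding sieve_mass_def by (simp only: of_real_sum of_real_prod)
  finally show ?thesis .
qed

text \<open>
  Erasing the numerator at \<open>q\<close> is injective on the shifts with a prescribed nonzero numerator there, does
  not increase the denominator, and multiplies the weight by \<open>-(q - 1)\<close>.
\<close>
lemma sum_weight_square_fixed_le:
  assumes P: "finite P" "\<And>p. p \<in> P \<Longrightarrow> prime p" and q: "q \<in> P" and c: "c \<noteq> 0"
  shows "(\<Sum>a | a \<in> shifts P Q \<and> a q = c. (weight P a)\<^sup>2) \<le> sieve_mass P Q / (real q - 1)\<^sup>2"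
proof -
  let ?A = "{a. a \<in> shifts P Q \<and> a q = c}"
  have q1: "q > 1" by (rule prime_gt_1_nat[OF P(2)[OF q]])
  have w: "(weight P a)\<^sup>2 = (weight P (a(q := 0)))\<^sup>2 / (real q - 1)\<^sup>2" if "a \<in> ?A" for a
  proof -
    have "weight P a = - 1 / (real q - 1) * (\<Prod>p\<in>P - {q}. if a p = 0 then 1 else - 1 / (real p - 1))"
      unfolding weight_def using that c by (subst prod.remove[OF P(1) q]) auto
    moreover have "weight P (a(q := 0)) = (\<Prod>p\<in>P - {q}. if a p = 0 then 1 else - 1 / (real p - 1))"
      unfolding weight_def by (subst prod.remove[OF P(1) q]) (auto intro!: prod.cong)
    ultimately show ?thesis by (simp add: power_divide power_mult_distrib)
  qed
  have inj: "inj_on (\<lambda>a. a(q := 0)) ?A"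
  proof (rule inj_onI)
    fix a b assume ab: "a \<in> ?A" "b \<in> ?A" "a(q := 0) = b(q := 0)"
    show "a = b"
    proof
      fix x show "a x = b x" using ab(1,2) fun_cong[OF ab(3), of x] by (cases "x = q") auto
    qed
  qed
  have img: "(\<lambda>a. a(q := 0)) ` ?A \<subseteq> shifts P Q"
  proof (rule image_subsetI)
    fix a assume a: "a \<in> ?A"
    have aP: "a \<in> PiE P (\<lambda>p. {..<p})" using a unfolding shifts_def by simp
    have "a(q := 0) \<in> PiE P (\<lambda>p. {..<p})"
    proof (rule PiE_I)
      fix p assume p: "p \<in> P"
      show "(a(q := 0)) p \<in> {..<p}" using PiE_mem[OF aP p] q1 by simp
    next
      fix p assume p: "p \<notin> P"
      hence "p \<noteq> q" using q by blast
      thus "(a(q := 0)) p = undefined" using PiE_arb[OF aP p] by simp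
    qed
    moreover have "\<Prod>{p\<in>P. (a(q := 0)) p \<noteq> 0} \<le> \<Prod>{p\<in>P. a p \<noteq> 0}"
    proof (rule dvd_imp_le)
      show "\<Prod>{p\<in>P. (a(q := 0)) p \<noteq> 0} dvd \<Prod>{p\<in>P. a p \<noteq> 0}"
        using P by (intro prod_dvd_prod_subset) auto
      show "0 < \<Prod>{p\<in>P. a p \<noteq> 0}" by (rule prod_primes_pos) (use P in auto)
    qed
    ultimately show "a(q := 0) \<in> shifts P Q" using a unfolding shifts_def by auto
  qed
  have "(\<Sum>a\<in>?A. (weight P a)\<^sup>2) = (\<Sum>a\<in>?A. (weight P (a(q := 0)))\<^sup>2) / (real q - 1)\<^sup>2"
    unfolding sum_divide_distrib by (rule sum.cong) (use w in auto)
  also have "(\<Sum>a\<in>?A. (weight P (a(q := 0)))\<^sup>2) = (\<Sum>b\<in>(\<lambda>a. a(q := 0)) ` ?A. (weight P b)\<^sup>2)"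
    by (simp add: sum.reindex[OF inj])
  also have "\<dots> \<le> (\<Sum>b\<in>shifts P Q. (weight P b)\<^sup>2)"
    by (rule sum_mono2[OF finite_shifts[OF P(1)] img]) simp
  also have "\<dots> = sieve_mass P Q" using P by (rule sum_weight_square)
  finally show ?thesis by (simp add: divide_right_mono)
qed

lemma sum_weight_square_nonzero_le:
  assumes P: "finite P" "\<And>p. p \<in> P \<Longrightarrow> prime p" and q: "q \<in> P"
  shows "(\<Sum>a | a \<in> shifts P Q \<and> a q \<noteq> 0. (weight P a)\<^sup>2) \<le> sieve_mass P Q / (real q - 1)"
proof -
  have q1: "q > 1" by (rule prime_gt_1_nat[OF P(2)[OF q]])
  have fin: "finite (shifts P Q)" by (rule finite_shifts[OF P(1)])
  have "{a. a \<in> shifts P Q \<and> a q \<noteq> 0} = (\<Union>c\<in>{1..<q}. {a. a \<in> shifts P Q \<and> a q = c})"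
  proof -
    have "a q \<in> {..<q}" if "a \<in> shifts P Q" for a
      using that q unfolding shifts_def by (blast intro: PiE_mem)
    thus ?thesis by fastforce
  qed
  hence "(\<Sum>a | a \<in> shifts P Q \<and> a q \<noteq> 0. (weight P a)\<^sup>2)
        = (\<Sum>c\<in>{1..<q}. \<Sum>a | a \<in> shifts P Q \<and> a q = c. (weight P a)\<^sup>2)"
    using fin by (simp only:) (rule sum.UNION_disjoint, auto)
  also have "\<dots> \<le> (\<Sum>c\<in>{1..<q}. sieve_mass P Q / (real q - 1)\<^sup>2)"
    using assms by (intro sum_mono sum_weight_square_fixed_le) auto
  also have "\<dots> = sieve_mass P Q / (real q - 1)"
    using q1 by (simp add: of_nat_diff power2_eq_square)
  finally show ?thesis .
qed

text \<open>
  The expression inside the absolute value is a multiple of \<open>1/\<Prod>D\<close>, hence zero. Multiplying the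
  resulting equation by \<open>\<Prod>D\<close> and reducing it modulo \<open>q\<close> leaves only the term of \<open>q\<close>.
\<close>
lemma dvd_of_near_integer:
  fixes t :: "nat \<Rightarrow> int" and k :: int
  assumes D: "finite D" "\<And>p. p \<in> D \<Longrightarrow> prime p"
    and near: "\<bar>(\<Sum>p\<in>D. of_int (t p) / real p) - of_int k\<bar> < 1 / real (\<Prod>D)" and q: "q \<in> D"
  shows "int q dvd t q"
proof -
  let ?\<Pi> = "int (\<Prod>D)"
  let ?r = "\<lambda>p. int (\<Prod>(D - {p}))"
  let ?I = "(\<Sum>p\<in>D. t p * ?r p) - k * ?\<Pi>"
  have pos: "\<Prod>D > 0" using D by (intro prod_primes_pos) auto
  have fac: "\<Prod>D = p * \<Prod>(D - {p})" if "p \<in> D" for p using D that by (simp add: prod.remove)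
  have "real_of_int ?I = real (\<Prod>D) * ((\<Sum>p\<in>D. of_int (t p) / real p) - of_int k)"
  proof -
    have "real (\<Prod>D) * (\<Sum>p\<in>D. of_int (t p) / real p) = (\<Sum>p\<in>D. of_int (t p * ?r p))"
      unfolding sum_distrib_left
    proof (rule sum.cong[OF refl])
      fix p assume p: "p \<in> D"
      hence "p > 0" using D prime_gt_0_nat by auto
      thus "real (\<Prod>D) * (of_int (t p) / real p) = of_int (t p * ?r p)"
        unfolding fac[OF p] by simp
    qed
    thus ?thesis by (simp add: right_diff_distrib mult.commute)
  qed
  hence "\<bar>real_of_int ?I\<bar> < 1"
    using near pos by (simp add: abs_mult pos_less_divide_eq mult.commute del: of_nat_prod)
  hence "?I = 0" by linarith
  hence eq: "(\<Sum>p\<in>D. t p * ?r p) = k * ?\<Pi>" by simp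
  have split: "(\<Sum>p\<in>D. t p * ?r p) = t q * ?r q + (\<Sum>p\<in>D - {q}. t p * ?r p)"
    by (rule sum.remove[OF D(1) q])
  have rest: "int q dvd (\<Sum>p\<in>D - {q}. t p * ?r p)"
  proof (intro dvd_sum dvd_mult)
    fix p assume "p \<in> D - {q}"
    hence "q dvd \<Prod>(D - {p})" using D q by (intro dvd_prodI) auto
    thus "int q dvd ?r p" by (simp only: of_nat_dvd_iff)
  qed
  have "int q dvd ?\<Pi>" unfolding fac[OF q] of_nat_mult by (rule dvd_triv_left)
  hence "int q dvd t q * ?r q + (\<Sum>p\<in>D - {q}. t p * ?r p)"
    unfolding split[symmetric] eq by (rule dvd_mult)
  hence dq: "int q dvd t q * ?r q" using rest by (simp only: dvd_add_left_iff)
  have ndvd: "\<not> int q dvd ?r q"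
  proof
    assume "int q dvd ?r q"
    hence "q dvd \<Prod>(D - {q})" by (simp only: of_nat_dvd_iff)
    then obtain p where p: "p \<in> D - {q}" "q dvd p"
      using prime_dvd_prod_iff[of "D - {q}" q "\<lambda>x. x"] D(1) D(2)[OF q] by auto
    have "q = p" by (rule primes_dvd_imp_eq) (use D q p in auto)
    thus False using p by simp
  qed
  have "prime (int q)" using D(2)[OF q] by simp
  thus ?thesis using prime_dvd_multD[OF _ dq] ndvd by blast
qed

section \<open>Separation of the shifts and correlation of their weights\<close>

lemma prod_primes_Un_le:
  assumes "finite A" "finite B" "\<And>p. p \<in> A \<union> B \<Longrightarrow> prime (p::nat)"
  shows "\<Prod>(A \<union> B) \<le> \<Prod>A * \<Prod>B"
proof -
  have "\<Prod>(A \<inter> B) > 0" by (rule prod_primes_pos) (use assms in auto)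
  hence "\<Prod>(A \<union> B) * 1 \<le> \<Prod>(A \<union> B) * \<Prod>(A \<inter> B)" by (intro mult_le_mono2) simp
  also have "\<dots> = \<Prod>A * \<Prod>B" using assms by (intro prod.union_inter)
  finally show ?thesis by simp
qed

lemma dvd_of_near_integer_supported:
  fixes t :: "nat \<Rightarrow> int" and k :: int
  assumes P: "finite P" "\<And>p. p \<in> P \<Longrightarrow> prime p"
    and D: "D \<subseteq> P" "\<And>p. p \<in> P - D \<Longrightarrow> t p = 0" "\<Prod>D \<le> X"
    and near: "\<bar>(\<Sum>p\<in>P. of_int (t p) / real p) - of_int k\<bar> < 1 / real X" and q: "q \<in> P"
  shows "int q dvd t q"
proof (cases "q \<in> D")
  case True
  have finD: "finite D" using P(1) D(1) finite_subset by blast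
  have pos: "\<Prod>D > 0" by (rule prod_primes_pos) (use P D in auto)
  have "(\<Sum>p\<in>P. of_int (t p) / real p) = (\<Sum>p\<in>D. of_int (t p) / real p)"
    by (rule sum.mono_neutral_right) (use P D in auto)
  moreover have "1 / real X \<le> 1 / real (\<Prod>D)"
    using pos D(3) by (intro divide_left_mono) (simp_all del: of_nat_prod)
  ultimately have "\<bar>(\<Sum>p\<in>D. of_int (t p) / real p) - of_int k\<bar> < 1 / real (\<Prod>D)"
    using near by linarith
  thus ?thesis using dvd_of_near_integer[OF finD _ _ True, of t k] P D by blast
next
  case False
  thus ?thesis using D q by simp
qed

lemma shifts_less:
  assumes "a \<in> shifts P Q" "p \<in> P"
  shows "a p < p"
  using assms unfolding shifts_def by (blast dest: PiE_mem)

lemma shifts_support_le: "a \<in> shifts P Q \<Longrightarrow> \<Prod>{p\<in>P. a p \<noteq> 0} \<le> Q"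
  by (simp add: shifts_def)

lemma int_dvd_diff_less_imp_eq:
  fixes x y p :: nat
  assumes "int p dvd int x - int y" "x < p" "y < p"
  shows "x = y"
proof -
  have "int x mod int p = int y mod int p" using assms(1) by (simp add: mod_eq_dvd_iff)
  thus ?thesis using assms by simp
qed

lemma shifts_eqI:
  assumes "a \<in> shifts P Q" "b \<in> shifts P Q" "\<And>p. p \<in> P \<Longrightarrow> int p dvd int (a p) - int (b p)"
  shows "a = b"
proof (rule PiE_ext[where s = "\<lambda>p. {..<p}"])
  fix p assume "p \<in> P"
  thus "a p = b p" using assms by (intro int_dvd_diff_less_imp_eq[of p]) (auto intro: shifts_less)
qed (use assms in \<open>simp_all add: shifts_def\<close>)

lemma shifts_separated:
  fixes k :: int
  assumes P: "finite P" "\<And>p. p \<in> P \<Longrightarrow> prime p" and m: "m > 0" "\<And>p. p \<in> P \<Longrightarrow> p dvd m"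
    and ab: "a \<in> shifts P Q" "b \<in> shifts P Q"
    and near: "\<bar>real (offset m P a) / real m - real (offset m P b) / real m - of_int k\<bar> < 1 / real (Q * Q)"
  shows "a = b"
proof (rule shifts_eqI[OF ab])
  fix q assume q: "q \<in> P"
  let ?S = "\<lambda>a. {p\<in>P. a p \<noteq> 0}"
  have pos: "p > 0" if "p \<in> P" for p using P(2)[OF that] prime_gt_0_nat by blast
  show "int q dvd int (a q) - int (b q)"
  proof (rule dvd_of_near_integer_supported[OF P, where D = "?S a \<union> ?S b" and X = "Q * Q" and k = k])
    have "\<Prod>(?S a \<union> ?S b) \<le> \<Prod>(?S a) * \<Prod>(?S b)" using P by (intro prod_primes_Un_le) auto
    also have "\<dots> \<le> Q * Q" using ab by (intro mult_le_mono shifts_support_le)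
    finally show "\<Prod>(?S a \<union> ?S b) \<le> Q * Q" .
    show "\<bar>(\<Sum>p\<in>P. of_int (int (a p) - int (b p)) / real p) - of_int k\<bar> < 1 / real (Q * Q)"
      using near by (simp add: offset_over_modulus[OF pos m] diff_divide_distrib sum_subtractf)
  qed (use q in auto)
qed

text \<open>
  Differences of two fractions have denominators up to \<open>Q\<^sup>2\<close>, so two differences that are closer than
  \<open>1/Q\<^sup>4\<close> modulo 1 are equal. Equality is stated prime by prime.
\<close>
lemma shift_differences_separated:
  fixes k :: int
  assumes P: "finite P" "\<And>p. p \<in> P \<Longrightarrow> prime p" and m: "m > 0" "\<And>p. p \<in> P \<Longrightarrow> p dvd m"
    and ab: "a \<in> shifts P Q" "a' \<in> shifts P Q" "c \<in> shifts P Q" "c' \<in> shifts P Q"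
    and near: "\<bar>(real (offset m P a) - real (offset m P a') - real (offset m P c) + real (offset m P c')) / real m - of_int k\<bar>
               < 1 / real (Q ^ 4)"
    and q: "q \<in> P"
  shows "int q dvd (int (a q) - int (a' q)) - (int (c q) - int (c' q))"
proof -
  let ?S = "\<lambda>a. {p\<in>P. a p \<noteq> 0}"
  have pos: "p > 0" if "p \<in> P" for p using P(2)[OF that] prime_gt_0_nat by blast
  show ?thesis
  proof (rule dvd_of_near_integer_supported[OF P, where D = "(?S a \<union> ?S a') \<union> (?S c \<union> ?S c')" and X = "Q ^ 4" and k = k])
    have "\<Prod>((?S a \<union> ?S a') \<union> (?S c \<union> ?S c')) \<le> \<Prod>(?S a \<union> ?S a') * \<Prod>(?S c \<union> ?S c')"
      using P by (intro prod_primes_Un_le) auto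
    also have "\<dots> \<le> (\<Prod>(?S a) * \<Prod>(?S a')) * (\<Prod>(?S c) * \<Prod>(?S c'))"
      using P by (intro mult_le_mono prod_primes_Un_le) auto
    also have "\<dots> \<le> (Q * Q) * (Q * Q)" using ab by (intro mult_le_mono shifts_support_le)
    finally show "\<Prod>((?S a \<union> ?S a') \<union> (?S c \<union> ?S c')) \<le> Q ^ 4" by (simp add: eval_nat_numeral mult.assoc)
    have "(\<Sum>p\<in>P. of_int ((int (a p) - int (a' p)) - (int (c p) - int (c' p))) / real p)
       = (real (offset m P a) - real (offset m P a') - real (offset m P c) + real (offset m P c')) / real m"
      by (simp add: offset_over_modulus[OF pos m] diff_divide_distrib add_divide_distrib sum_subtractf sum.distrib)
    thus "\<bar>(\<Sum>p\<in>P. of_int ((int (a p) - int (a' p)) - (int (c p) - int (c' p))) / real p) - of_int k\<bar> < 1 / real (Q ^ 4)"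
      using near by simp
  qed (use q in auto)
qed

lemma sum_pairs_le:
  fixes f :: "'a \<Rightarrow> real"
  assumes "finite A" "finite B" "inj_on fst R" "inj_on snd R" "fst ` R \<subseteq> A" "snd ` R \<subseteq> B"
    and X: "(\<Sum>a\<in>A. (f a)\<^sup>2) \<le> X" and Y: "(\<Sum>a\<in>B. (f a)\<^sup>2) \<le> Y" and t: "t > 0"
  shows "(\<Sum>x\<in>R. \<bar>f (fst x)\<bar> * \<bar>f (snd x)\<bar>) \<le> (t * X + Y / t) / 2"
proof -
  \<comment> \<open>Weighted arithmetic-geometric mean inequality; the callers choose \<open>t\<close> to balance \<open>X\<close> and \<open>Y\<close>.\<close>
  have young: "\<bar>x\<bar> * \<bar>y\<bar> \<le> (t * x\<^sup>2 + y\<^sup>2 / t) / 2" for x y :: real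
  proof -
    have "0 \<le> (t * \<bar>x\<bar> - \<bar>y\<bar>)\<^sup>2" by simp
    thus ?thesis using t by (simp add: power2_eq_square field_simps)
  qed
  have "(\<Sum>x\<in>R. \<bar>f (fst x)\<bar> * \<bar>f (snd x)\<bar>) \<le> (\<Sum>x\<in>R. (t * (f (fst x))\<^sup>2 + (f (snd x))\<^sup>2 / t) / 2)"
    by (intro sum_mono young)
  also have "\<dots> = (t * (\<Sum>x\<in>R. (f (fst x))\<^sup>2) + (\<Sum>x\<in>R. (f (snd x))\<^sup>2) / t) / 2"
    by (simp only: sum_divide_distrib[symmetric] sum.distrib sum_distrib_left[symmetric])
  also have "(\<Sum>x\<in>R. (f (fst x))\<^sup>2) = (\<Sum>a\<in>fst ` R. (f a)\<^sup>2)" using assms by (simp add: sum.reindex)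
  also have "(\<Sum>x\<in>R. (f (snd x))\<^sup>2) = (\<Sum>a\<in>snd ` R. (f a)\<^sup>2)" using assms by (simp add: sum.reindex)
  also have "(t * (\<Sum>a\<in>fst ` R. (f a)\<^sup>2) + (\<Sum>a\<in>snd ` R. (f a)\<^sup>2) / t) / 2 \<le> (t * X + Y / t) / 2"
  proof (intro divide_right_mono add_mono mult_left_mono)
    show "(\<Sum>a\<in>fst ` R. (f a)\<^sup>2) \<le> X" by (rule order_trans[OF sum_mono2 X]) (use assms in auto)
    show "(\<Sum>a\<in>snd ` R. (f a)\<^sup>2) \<le> Y" by (rule order_trans[OF sum_mono2 Y]) (use assms in auto)
  qed (use t in auto)
  finally show ?thesis .
qed

text \<open>
  The relation \<open>R\<close> consists of pairs of fractions with one common difference \<open>\<delta> \<noteq> 0\<close>. Choose a prime \<open>q\<close> at which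
  \<open>\<delta>\<close> has a nonzero numerator. Either the first or the second fraction has numerator 0 at \<open>q\<close>, in which case the numerator of the
  other one is fixed and nonzero, or both numerators are nonzero. In each of the three cases the sums of the
  squared weights of the first and of the second fractions have a product of at most \<open>(L/(q - 1))\<^sup>2\<close>.
\<close>
lemma weight_correlation_le:
  assumes P: "finite P" "\<And>p. p \<in> P \<Longrightarrow> prime p" "\<And>p. p \<in> P \<Longrightarrow> z < p" and z: "z > 0"
    and R: "R \<subseteq> shifts P Q \<times> shifts P Q" "\<And>a a'. (a, a') \<in> R \<Longrightarrow> a \<noteq> a'"
    and same: "\<And>a a' c c' p. (a, a') \<in> R \<Longrightarrow> (c, c') \<in> R \<Longrightarrow> p \<in> P \<Longrightarrow>
                 int p dvd (int (a p) - int (a' p)) - (int (c p) - int (c' p))"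
  shows "(\<Sum>x\<in>R. \<bar>weight P (fst x)\<bar> * \<bar>weight P (snd x)\<bar>) \<le> 3 * sieve_mass P Q / real z"
proof (cases "R = {}")
  case True
  thus ?thesis using sieve_mass_nonneg[OF P(2)] by simp
next
  case False
  define L where "L = sieve_mass P Q"
  have L0: "L \<ge> 0" unfolding L_def by (rule sieve_mass_nonneg[OF P(2)])
  obtain a0 a0' where a0: "(a0, a0') \<in> R" using False by auto
  have a0s: "a0 \<in> shifts P Q" "a0' \<in> shifts P Q" using a0 R(1) by auto
  have "\<exists>q\<in>P. \<not> int q dvd int (a0 q) - int (a0' q)"
    using shifts_eqI[OF a0s] R(2)[OF a0] by blast
  then obtain q where q: "q \<in> P" "\<not> int q dvd int (a0 q) - int (a0' q)" by blast
  have ne: "a q \<noteq> a' q" if "(a, a') \<in> R" for a a'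
  proof
    assume "a q = a' q"
    hence "int q dvd int (a0 q) - int (a0' q)" using same[OF a0 that q(1)] by simp
    thus False using q by simp
  qed
  have zq: "real q - 1 \<ge> real z" "real q - 1 > 0" using P(3)[OF q(1)] z by linarith+
  have half: "(1 / r * L + (L / r\<^sup>2) / (1 / r)) / 2 = L / r" "(r * (L / r\<^sup>2) + L / r) / 2 = L / r"
    if "r > 0" for r :: real using that by (simp_all add: power2_eq_square)
  have fin: "finite (shifts P Q)" by (rule finite_shifts[OF P(1)])
  have finR: "finite R" using R(1) fin finite_subset by blast
  have injf: "inj_on fst R"
  proof (rule inj_onI, clarsimp)
    fix a b b' assume r: "(a, b) \<in> R" "(a, b') \<in> R"
    show "b = b'"
    proof (rule shifts_eqI[of _ P Q])
      fix p assume "p \<in> P"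
      from same[OF r(2) r(1) this] show "int p dvd int (b p) - int (b' p)" by simp
    qed (use r R in auto)
  qed
  have injs: "inj_on snd R"
  proof (rule inj_onI, clarsimp)
    fix a b b' assume r: "(b, a) \<in> R" "(b', a) \<in> R"
    show "b = b'"
    proof (rule shifts_eqI[of _ P Q])
      fix p assume "p \<in> P"
      from same[OF r(1) r(2) this] show "int p dvd int (b p) - int (b' p)" by simp
    qed (use r R in auto)
  qed
  let ?w = "weight P"
  let ?g = "\<lambda>x. \<bar>?w (fst x)\<bar> * \<bar>?w (snd x)\<bar>"
  let ?R1 = "{x\<in>R. fst x q = 0}" and ?R2 = "{x\<in>R. snd x q = 0}" and ?R3 = "{x\<in>R. fst x q \<noteq> 0 \<and> snd x q \<noteq> 0}"
  have tot: "(\<Sum>a\<in>shifts P Q. (?w a)\<^sup>2) \<le> L" unfolding L_def by (simp add: sum_weight_square[OF P(1,2)])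
  have one: "(\<Sum>a | a \<in> shifts P Q \<and> a q = c. (?w a)\<^sup>2) \<le> L / (real q - 1)\<^sup>2" if "c \<noteq> 0" for c
    unfolding L_def by (rule sum_weight_square_fixed_le[OF P(1,2) q(1) that])
  have nz: "(\<Sum>a | a \<in> shifts P Q \<and> a q \<noteq> 0. (?w a)\<^sup>2) \<le> L / (real q - 1)"
    unfolding L_def by (rule sum_weight_square_nonzero_le[OF P(1,2) q(1)])
  have fx: "fst x \<in> shifts P Q" "snd x \<in> shifts P Q" if "x \<in> R" for x using R(1) that by auto
  have "(\<Sum>x\<in>?R1. ?g x) \<le> L / (real q - 1)"
  proof (cases "?R1 = {}")
    case False
    then obtain d d' where d: "(d, d') \<in> R" "d q = 0" by auto
    have d'0: "d' q \<noteq> 0" using ne[OF d(1)] d(2) by simp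
    have sub: "snd ` ?R1 \<subseteq> {a. a \<in> shifts P Q \<and> a q = d' q}"
    proof (rule image_subsetI)
      fix x assume x: "x \<in> ?R1"
      have "int q dvd (int (fst x q) - int (snd x q)) - (int (d q) - int (d' q))"
        using x by (intro same[OF _ d(1) q(1)]) auto
      hence "int q dvd int (d' q) - int (snd x q)" using x d by simp
      moreover have "snd x q < q" "d' q < q"
        using shifts_less[OF _ q(1)] fx[of x] fx[OF d(1)] x by auto
      ultimately have "d' q = snd x q" by (intro int_dvd_diff_less_imp_eq)
      thus "snd x \<in> {a. a \<in> shifts P Q \<and> a q = d' q}" using x fx by auto
    qed
    have "(\<Sum>x\<in>?R1. ?g x) \<le> (1 / (real q - 1) * L + (L / (real q - 1)\<^sup>2) / (1 / (real q - 1))) / 2"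
      by (rule sum_pairs_le[OF fin _ _ _ _ sub tot one[OF d'0]])
        (use fin fx zq in \<open>auto intro: inj_on_subset[OF injf] inj_on_subset[OF injs]\<close>)
    also have "\<dots> = L / (real q - 1)" using half(1)[OF zq(2)] .
    finally show ?thesis .
  next
    case True
    show ?thesis unfolding True using L0 zq by simp
  qed
  moreover have "(\<Sum>x\<in>?R2. ?g x) \<le> L / (real q - 1)"
  proof (cases "?R2 = {}")
    case False
    then obtain d d' where d: "(d, d') \<in> R" "d' q = 0" by auto
    have d'0: "d q \<noteq> 0" using ne[OF d(1)] d(2) by simp
    have sub: "fst ` ?R2 \<subseteq> {a. a \<in> shifts P Q \<and> a q = d q}"
    proof (rule image_subsetI)
      fix x assume x: "x \<in> ?R2"
      have "int q dvd (int (fst x q) - int (snd x q)) - (int (d q) - int (d' q))"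
        using x by (intro same[OF _ d(1) q(1)]) auto
      hence "int q dvd int (fst x q) - int (d q)" using x d by simp
      moreover have "fst x q < q" "d q < q"
        using shifts_less[OF _ q(1)] fx[of x] fx[OF d(1)] x by auto
      ultimately have "fst x q = d q" by (intro int_dvd_diff_less_imp_eq)
      thus "fst x \<in> {a. a \<in> shifts P Q \<and> a q = d q}" using x fx by auto
    qed
    have "(\<Sum>x\<in>?R2. ?g x) \<le> ((real q - 1) * (L / (real q - 1)\<^sup>2) + L / (real q - 1)) / 2"
      by (rule sum_pairs_le[OF _ fin _ _ sub _ one[OF d'0] tot])
        (use fin fx zq in \<open>auto intro: inj_on_subset[OF injf] inj_on_subset[OF injs]\<close>)
    also have "\<dots> = L / (real q - 1)" using half(2)[OF zq(2)] .
    finally show ?thesis .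
  next
    case True
    show ?thesis unfolding True using L0 zq by simp
  qed
  moreover have "(\<Sum>x\<in>?R3. ?g x) \<le> L / (real q - 1)"
  proof -
    have "(\<Sum>x\<in>?R3. ?g x) \<le> (1 * (L / (real q - 1)) + L / (real q - 1) / 1) / 2"
      by (rule sum_pairs_le[OF _ _ _ _ _ _ nz nz])
        (use fin fx zq in \<open>auto intro: inj_on_subset[OF injf] inj_on_subset[OF injs]\<close>)
    also have "\<dots> = L / (real q - 1)" by (simp only: mult_1 div_by_1 field_sum_of_halves add_divide_distrib)
    finally show ?thesis .
  qed
  moreover have "(\<Sum>x\<in>R. ?g x) \<le> (\<Sum>x\<in>?R1. ?g x) + (\<Sum>x\<in>?R2. ?g x) + (\<Sum>x\<in>?R3. ?g x)"
  proof -
    have "(\<Sum>x\<in>R. ?g x) = (\<Sum>x\<in>(?R1 \<union> ?R2) \<union> ?R3. ?g x)" by (rule sum.cong) auto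
    also have "\<dots> \<le> (\<Sum>x\<in>?R1 \<union> ?R2. ?g x) + (\<Sum>x\<in>?R3. ?g x)"
      using finR by (subst sum_Un) (auto intro!: sum_nonneg)
    also have "(\<Sum>x\<in>?R1 \<union> ?R2. ?g x) \<le> (\<Sum>x\<in>?R1. ?g x) + (\<Sum>x\<in>?R2. ?g x)"
      using finR by (subst sum_Un) (auto intro!: sum_nonneg)
    finally show ?thesis by simp
  qed
  ultimately have "(\<Sum>x\<in>R. ?g x) \<le> 3 * L / (real q - 1)" by simp
  also have "\<dots> \<le> 3 * L / real z" using zq z L0 by (intro divide_left_mono) auto
  finally show ?thesis unfolding L_def .
qed

section \<open>Exponential sums on a finite cyclic grid\<close>

definition expsum :: "nat set \<Rightarrow> (nat \<Rightarrow> complex) \<Rightarrow> real \<Rightarrow> complex" where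
  "expsum I v x = (\<Sum>n\<in>I. v n * e (real n * x))"

lemma expsum_mod:
  assumes "m > 0"
  shows "expsum I v (real (y mod m) / real m) = expsum I v (real y / real m)"
proof -
  have "real y / real m = real (m * (y div m) + y mod m) / real m" by (simp only: mult_div_mod_eq)
  also have "\<dots> = real (y mod m) / real m + real (y div m)"
    using assms by (simp only: of_nat_add of_nat_mult) (simp add: add_divide_distrib)
  finally have *: "real y / real m = real (y mod m) / real m + real (y div m)" .
  have "e (real n * (real y / real m)) = e (real n * (real (y mod m) / real m))" for n
  proof -
    have "real n * (real y / real m) = real n * (real (y mod m) / real m) + real (n * (y div m))"
      unfolding * by (simp add: distrib_left)
    thus ?thesis by (simp only: e_add e_of_nat mult_1_right)
  qed
  thus ?thesis unfolding expsum_def by simp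
qed

lemma sum_norm_expsum_square:
  assumes "m > 0" "finite I" and sep: "\<And>n n'. n \<in> I \<Longrightarrow> n' \<in> I \<Longrightarrow> n < n' \<Longrightarrow> n' - n < m"
  shows "(\<Sum>k<m. (norm (expsum I v (real k / real m)))\<^sup>2) = real m * (\<Sum>n\<in>I. (norm (v n))\<^sup>2)"
proof -
  have orth: "(\<Sum>k<m. e (real k * ((real n - real n') / real m))) = (if n = n' then of_nat m else 0)"
    if "n \<in> I" "n' \<in> I" for n n'
  proof (cases "n = n'")
    case False
    have "(\<Sum>k<m. e (real k * ((real n - real n') / real m))) = 0"
    proof (rule sum_e_geometric)
      show "(real n - real n') / real m \<notin> \<int>"
      proof
        assume "(real n - real n') / real m \<in> \<int>"
        then obtain k where "(real n - real n') / real m = of_int k" by (elim Ints_cases)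
        hence "real_of_int (int n - int n') = real_of_int (k * int m)" using assms by (simp add: field_simps)
        hence eq: "int n - int n' = k * int m" by (simp only: of_int_eq_iff)
        have "\<bar>int n - int n'\<bar> < int m" using sep[of n n'] sep[of n' n] that False by linarith
        hence "\<bar>k\<bar> * int m < 1 * int m" unfolding eq by (simp add: abs_mult)
        hence "k = 0" using assms(1) by (subst (asm) mult_less_cancel_right) auto
        thus False using eq False by simp
      qed
      have "real m * ((real n - real n') / real m) = of_int (int n - int n')" using assms by simp
      thus "real m * ((real n - real n') / real m) \<in> \<int>" by (simp only: Ints_of_int)
    qed fact
    thus ?thesis using False by simp
  qed simp
  have "complex_of_real (\<Sum>k<m. (norm (expsum I v (real k / real m)))\<^sup>2)
      = (\<Sum>k<m. expsum I v (real k / real m) * cnj (expsum I v (real k / real m)))"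
    by (simp only: of_real_sum complex_norm_square)
  also have "\<dots> = (\<Sum>k<m. \<Sum>n\<in>I. \<Sum>n'\<in>I. v n * cnj (v n') * e (real k * ((real n - real n') / real m)))"
  proof (rule sum.cong[OF refl])
    fix k
    have "e (real n * (real k / real m)) * cnj (e (real n' * (real k / real m)))
          = e (real k * ((real n - real n') / real m))" for n n'
      unfolding e_minus[symmetric] e_add[symmetric] by (simp add: diff_divide_distrib algebra_simps)
    moreover have "v n * e (real n * (real k / real m)) * cnj (v n' * e (real n' * (real k / real m)))
          = v n * cnj (v n') * (e (real n * (real k / real m)) * cnj (e (real n' * (real k / real m))))" for n n'
      by (simp only: complex_cnj_mult mult_ac)
    ultimately have "v n * e (real n * (real k / real m)) * cnj (v n' * e (real n' * (real k / real m)))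
          = v n * cnj (v n') * e (real k * ((real n - real n') / real m))" for n n'
      by (simp only:)
    thus "expsum I v (real k / real m) * cnj (expsum I v (real k / real m))
       = (\<Sum>n\<in>I. \<Sum>n'\<in>I. v n * cnj (v n') * e (real k * ((real n - real n') / real m)))"
      unfolding expsum_def cnj_sum sum_product by (simp only:)
  qed
  also have "\<dots> = (\<Sum>n\<in>I. \<Sum>n'\<in>I. \<Sum>k<m. v n * cnj (v n') * e (real k * ((real n - real n') / real m)))"
    by (subst sum.swap, rule sum.cong[OF refl], rule sum.swap)
  also have "\<dots> = (\<Sum>n\<in>I. \<Sum>n'\<in>I. v n * cnj (v n') * (if n = n' then of_nat m else 0))"
    using orth by (simp add: sum_distrib_left[symmetric])
  also have "\<dots> = (\<Sum>n\<in>I. v n * cnj (v n) * of_nat m)"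
    using assms(2) by (simp add: if_distrib[of "\<lambda>x. _ * x"] cong: if_cong)
  also have "\<dots> = complex_of_real (real m * (\<Sum>n\<in>I. (norm (v n))\<^sup>2))"
    by (simp add: complex_norm_square[symmetric] sum_distrib_left mult.commute)
  finally show ?thesis by (simp only: of_real_eq_iff)
qed

text \<open>
  The duality step: a combination of values of a periodic function is a scalar product on the residues
  modulo \<open>m\<close>, so Cauchy-Schwarz leaves the \<open>L\<^sup>2\<close> norm of \<open>F\<close> and the number of weighted coincidences among the
  evaluation points.
\<close>
lemma norm_sum_translates_square_le:
  fixes F :: "nat \<Rightarrow> complex" and c :: "'i \<Rightarrow> complex"
  assumes "m > 0" and per: "\<And>k. F (k mod m) = F k" and fin: "finite A"
  shows "(norm (\<Sum>i\<in>A. c i * F (y i)))\<^sup>2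
    \<le> (\<Sum>k<m. (norm (F k))\<^sup>2) * (\<Sum>i\<in>A. \<Sum>j\<in>A. if y i mod m = y j mod m then norm (c i) * norm (c j) else 0)"
proof -
  let ?w = "\<lambda>k. \<Sum>i\<in>A. if y i mod m = k then norm (c i) else 0"
  have "norm (\<Sum>i\<in>A. c i * F (y i)) \<le> (\<Sum>i\<in>A. norm (c i) * norm (F (y i)))"
    by (intro order_trans[OF norm_sum]) (simp add: norm_mult)
  also have "\<dots> = (\<Sum>i\<in>A. \<Sum>k<m. norm (F k) * (if y i mod m = k then norm (c i) else 0))"
  proof (rule sum.cong[OF refl])
    fix i
    have "(\<Sum>k<m. norm (F k) * (if y i mod m = k then norm (c i) else 0))
        = (\<Sum>k<m. if y i mod m = k then norm (F k) * norm (c i) else 0)"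
      by (rule sum.cong) auto
    also have "\<dots> = norm (c i) * norm (F (y i))"
      using assms(1) per[of "y i"] by (simp add: mult.commute)
    finally show "norm (c i) * norm (F (y i)) = (\<Sum>k<m. norm (F k) * (if y i mod m = k then norm (c i) else 0))" ..
  qed
  also have "\<dots> = (\<Sum>k<m. norm (F k) * ?w k)"
    by (subst sum.swap) (simp only: sum_distrib_left)
  finally have "(norm (\<Sum>i\<in>A. c i * F (y i)))\<^sup>2 \<le> (\<Sum>k<m. norm (F k) * ?w k)\<^sup>2"
    by (intro power_mono) auto
  also have "\<dots> \<le> (\<Sum>k<m. (norm (F k))\<^sup>2) * (\<Sum>k<m. (?w k)\<^sup>2)"
    by (rule Cauchy_Schwarz_ineq_sum)
  also have "(\<Sum>k<m. (?w k)\<^sup>2) = (\<Sum>i\<in>A. \<Sum>j\<in>A. if y i mod m = y j mod m then norm (c i) * norm (c j) else 0)"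
  proof -
    have "(\<Sum>k<m. (?w k)\<^sup>2) = (\<Sum>k<m. \<Sum>i\<in>A. \<Sum>j\<in>A. (if y i mod m = k then norm (c i) else 0) * (if y j mod m = k then norm (c j) else 0))"
      by (simp only: power2_eq_square sum_product)
    also have "\<dots> = (\<Sum>i\<in>A. \<Sum>j\<in>A. \<Sum>k<m. (if y i mod m = k then norm (c i) else 0) * (if y j mod m = k then norm (c j) else 0))"
      by (subst sum.swap, rule sum.cong[OF refl], rule sum.swap)
    also have "\<dots> = (\<Sum>i\<in>A. \<Sum>j\<in>A. if y i mod m = y j mod m then norm (c i) * norm (c j) else 0)"
    proof (rule sum.cong[OF refl], rule sum.cong[OF refl])
      fix i j
      have "(\<Sum>k<m. (if y i mod m = k then norm (c i) else 0) * (if y j mod m = k then norm (c j) else 0))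
          = (\<Sum>k<m. if y i mod m = k then norm (c i) * (if y j mod m = k then norm (c j) else 0) else 0)"
        by (rule sum.cong) auto
      also have "\<dots> = norm (c i) * (if y j mod m = y i mod m then norm (c j) else 0)"
        using assms(1) by simp
      also have "\<dots> = (if y i mod m = y j mod m then norm (c i) * norm (c j) else 0)" by auto
      finally show "(\<Sum>k<m. (if y i mod m = k then norm (c i) else 0) * (if y j mod m = k then norm (c j) else 0))
          = (if y i mod m = y j mod m then norm (c i) * norm (c j) else 0)" .
    qed
    finally show ?thesis .
  qed
  finally show ?thesis .
qed

lemma cos_ge_one_minus_square: "1 - x\<^sup>2 / 2 \<le> cos (x::real)"
proof -
  have "cos x = 1 - 2 * (sin (x / 2))\<^sup>2" using cos_double_sin[of "x / 2"] by simp
  moreover have "(sin (x / 2))\<^sup>2 \<le> (x / 2)\<^sup>2"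
    using abs_sin_x_le_abs_x[of "x / 2"] by (simp only: abs_le_square_iff)
  ultimately show ?thesis by (simp add: power2_eq_square)
qed

lemma sum_centred_squares: "(\<Sum>b<W. (real b - (real W - 1) / 2)\<^sup>2) = real W * ((real W)\<^sup>2 - 1) / 12"
proof -
  have 1: "(\<Sum>b<W. real b) = real W * (real W - 1) / 2" for W :: nat
    by (induction W) (simp_all add: field_simps)
  have 2: "(\<Sum>b<W. (real b)\<^sup>2) = real W * (real W - 1) * (2 * real W - 1) / 6" for W :: nat
    by (induction W) (simp_all add: field_simps power2_eq_square)
  have "(\<Sum>b<W. (real b - (real W - 1) / 2)\<^sup>2)
      = (\<Sum>b<W. (real b)\<^sup>2 - (real W - 1) * real b + ((real W - 1) / 2)\<^sup>2)"
    by (rule sum.cong) (simp_all add: power2_eq_square algebra_simps)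
  also have "\<dots> = (\<Sum>b<W. (real b)\<^sup>2) - (real W - 1) * (\<Sum>b<W. real b) + real W * ((real W - 1) / 2)\<^sup>2"
    by (simp add: sum.distrib sum_subtractf sum_distrib_left)
  also have "\<dots> = real W * ((real W)\<^sup>2 - 1) / 12"
    unfolding 1 2 by (simp add: field_simps power2_eq_square)
  finally show ?thesis .
qed

text \<open>
  After removing the phase at the midpoint, all phases are at most \<open>\<pi>/2\<close> in absolute value, and \<open>1 - x\<^sup>2/2 \<le> cos x\<close> bounds
  the real part from below.
\<close>
lemma norm_window_sum_ge:
  assumes "W > 0" "\<bar>\<theta>\<bar> \<le> 1 / (2 * real W)"
  shows "norm (\<Sum>b<W. e (\<theta> * real b)) \<ge> 7 / 12 * real W"
proof -
  let ?c = "\<lambda>b. real b - (real W - 1) / 2"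
  have "(\<Sum>b<W. e (\<theta> * real b)) = e (\<theta> * (real W - 1) / 2) * (\<Sum>b<W. e (\<theta> * ?c b))"
    unfolding sum_distrib_left e_add[symmetric] by (intro sum.cong refl arg_cong[where f = e]) (simp add: algebra_simps)
  hence "norm (\<Sum>b<W. e (\<theta> * real b)) = norm (\<Sum>b<W. e (\<theta> * ?c b))" by (simp add: norm_mult)
  also have "\<dots> \<ge> Re (\<Sum>b<W. e (\<theta> * ?c b))" by (rule complex_Re_le_cmod)
  also have "Re (\<Sum>b<W. e (\<theta> * ?c b)) = (\<Sum>b<W. cos (2 * pi * \<theta> * ?c b))"
    by (simp add: e_def Re_exp mult_ac)
  also have "\<dots> \<ge> (\<Sum>b<W. 1 - (2 * pi * \<theta> * ?c b)\<^sup>2 / 2)"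
    by (intro sum_mono cos_ge_one_minus_square)
  also have "(\<Sum>b<W. 1 - (2 * pi * \<theta> * ?c b)\<^sup>2 / 2) = real W - 2 * pi\<^sup>2 * \<theta>\<^sup>2 * (\<Sum>b<W. (?c b)\<^sup>2)"
    by (simp add: sum_subtractf sum_distrib_left power_mult_distrib mult.assoc)
  also have "\<dots> = real W - real W * (pi\<^sup>2 * (\<theta>\<^sup>2 * ((real W)\<^sup>2 - 1))) / 6"
    unfolding sum_centred_squares by (simp add: field_simps)
  also have "\<dots> \<ge> real W - real W * (10 * (1 / 4)) / 6"
  proof -
    have "\<theta>\<^sup>2 \<le> (1 / (2 * real W))\<^sup>2" using power_mono[OF assms(2), of 2] by simp
    hence "\<theta>\<^sup>2 * (real W)\<^sup>2 \<le> 1 / 4" using assms(1) by (simp add: field_simps power2_eq_square)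
    moreover have "\<theta>\<^sup>2 * ((real W)\<^sup>2 - 1) \<le> \<theta>\<^sup>2 * (real W)\<^sup>2" by (intro mult_left_mono) auto
    ultimately have t: "\<theta>\<^sup>2 * ((real W)\<^sup>2 - 1) \<le> 1 / 4" by linarith
    have "pi \<le> 63 / 20" by (rule order_trans[OF pi_approx(2)]) simp
    hence "pi * pi \<le> 63 / 20 * (63 / 20)" by (intro mult_mono) auto
    hence "pi\<^sup>2 \<le> 10" by (simp add: power2_eq_square)
    moreover have "0 \<le> \<theta>\<^sup>2 * ((real W)\<^sup>2 - 1)" using assms(1) by (simp add: one_le_power)
    ultimately have "pi\<^sup>2 * (\<theta>\<^sup>2 * ((real W)\<^sup>2 - 1)) \<le> 10 * (1 / 4)" using t by (intro mult_mono) auto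
    thus ?thesis by (intro diff_left_mono divide_right_mono mult_left_mono) auto
  qed
  finally show ?thesis by simp
qed

section \<open>Sifted exponential sums on small sets\<close>

text \<open>
  An exponential sum over integers that are coprime to the primes in \<open>P\<close> and lie within \<open>N/2\<close> of \<open>n0\<close>. It is
  sampled at the multiples of \<open>1/m\<close> with \<open>m = NW\<close>, so that a window of length \<open>1/N\<close> contains \<open>W\<close> grid points.
\<close>
locale sieved_sum =
  fixes P I :: "nat set" and Q N W :: nat and n0 :: real and u :: "nat \<Rightarrow> complex"
  assumes finite_P: "finite P" and prime_P: "\<And>p. p \<in> P \<Longrightarrow> prime p"
    and dvd_W: "\<And>p. p \<in> P \<Longrightarrow> p dvd W" and W_pos: "W > 0" and N_pos: "N > 0"
    and finite_I: "finite I" and coprime_I: "\<And>n p. n \<in> I \<Longrightarrow> p \<in> P \<Longrightarrow> \<not> p dvd n"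
    and near_centre: "\<And>n. n \<in> I \<Longrightarrow> \<bar>real n - n0\<bar> \<le> real N / 2"
    and spread: "\<And>n n'. n \<in> I \<Longrightarrow> n' \<in> I \<Longrightarrow> n < n' \<Longrightarrow> n' - n < N"
begin

definition "m = N * W"
definition "L = sieve_mass P Q"
definition "S j = expsum I u (real j / real m)"
definition "B = (\<Sum>n\<in>I. (norm (u n))\<^sup>2)"
definition "phase b = e (- n0 * real b / real m)"
text \<open>
  Averaging over a window multiplies the coefficient at the frequency \<open>n\<close> by \<open>\<kappa> n\<close>; dividing the
  coefficients by \<open>\<kappa>\<close> beforehand compensates for it at bounded cost.
\<close>
definition "\<kappa> n = (\<Sum>b<W. e ((real n - n0) / real m * real b)) / of_nat W"
definition "v n = u n / \<kappa> n"
definition "F k = expsum I v (real k / real m)"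

lemma m_pos: "m > 0" and W_le_m: "W \<le> m" and dvd_m: "p \<in> P \<Longrightarrow> p dvd m"
  using N_pos W_pos dvd_W by (auto simp: m_def)

lemma B_nonneg: "B \<ge> 0" unfolding B_def by (intro sum_nonneg) simp

lemma L_nonneg: "L \<ge> 0" unfolding L_def by (rule sieve_mass_nonneg[OF prime_P])

lemma norm_\<kappa>_ge: "norm (\<kappa> n) \<ge> 7 / 12" if "n \<in> I"
proof -
  have "\<bar>real n - n0\<bar> / real m \<le> real N / 2 / real m"
    by (rule divide_right_mono[OF near_centre[OF that]]) simp
  hence "\<bar>(real n - n0) / real m\<bar> \<le> real N / 2 / real m" by (simp only: abs_divide abs_of_nat)
  also have "\<dots> = 1 / (2 * real W)" using N_pos by (simp add: m_def)
  finally have "norm (\<Sum>b<W. e ((real n - n0) / real m * real b)) \<ge> 7 / 12 * real W"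
    by (rule norm_window_sum_ge[OF W_pos])
  thus ?thesis using W_pos by (simp add: \<kappa>_def norm_divide pos_le_divide_eq)
qed

lemma sum_norm_F_square_le: "(\<Sum>k<m. (norm (F k))\<^sup>2) \<le> 3 * real m * B"
proof -
  have "(\<Sum>k<m. (norm (F k))\<^sup>2) = real m * (\<Sum>n\<in>I. (norm (v n))\<^sup>2)"
    unfolding F_def
  proof (rule sum_norm_expsum_square[OF m_pos finite_I])
    fix n n' assume "n \<in> I" "n' \<in> I" "n < n'"
    hence "n' - n < N" by (rule spread)
    also have "N \<le> m" using W_pos by (simp add: m_def)
    finally show "n' - n < m" .
  qed
  also have "(\<Sum>n\<in>I. (norm (v n))\<^sup>2) \<le> (\<Sum>n\<in>I. 3 * (norm (u n))\<^sup>2)"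
  proof (rule sum_mono)
    fix n assume n: "n \<in> I"
    have "(norm (\<kappa> n))\<^sup>2 \<ge> (7 / 12)\<^sup>2" using norm_\<kappa>_ge[OF n] by (intro power_mono) auto
    hence "(norm (\<kappa> n))\<^sup>2 \<ge> 1 / 3" by (simp add: power2_eq_square)
    hence "(norm (u n))\<^sup>2 / (norm (\<kappa> n))\<^sup>2 \<le> (norm (u n))\<^sup>2 / (1 / 3)"
      by (intro divide_left_mono) auto
    thus "(norm (v n))\<^sup>2 \<le> 3 * (norm (u n))\<^sup>2" by (simp add: v_def norm_divide power_divide)
  qed
  finally show ?thesis using m_pos by (simp add: B_def sum_distrib_left mult_ac)
qed

lemma F_mod: "F (k mod m) = F k"
  unfolding F_def by (rule expsum_mod[OF m_pos])

text \<open>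
  On the left-hand side the coefficient of \<open>F\<close> at the frequency \<open>n\<close> is multiplied by \<open>L\<close>, from the sum over fractions, and
  by \<open>W \<kappa> n\<close>, from the window.
\<close>
lemma reproducing_identity:
  "(\<Sum>(a, b)\<in>shifts P Q \<times> {..<W}. of_real (weight P a) * phase b * F (j + offset m P a + b)) = of_real (L * real W) * S j"
proof -
  let ?A = "shifts P Q"
  let ?x = "\<lambda>n a. of_real (weight P a) * e (real n * real (offset m P a) / real m)"
  let ?y = "\<lambda>n b. phase b * e (real n * real b / real m)"
  have "(\<Sum>(a, b)\<in>?A \<times> {..<W}. of_real (weight P a) * phase b * F (j + offset m P a + b))
      = (\<Sum>(a, b)\<in>?A \<times> {..<W}. \<Sum>n\<in>I. v n * e (real n * (real j / real m)) * (?x n a * ?y n b))"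
  proof (rule sum.cong[OF refl], clarify)
    fix a b
    have "e (real n * (real (j + offset m P a + b) / real m))
       = e (real n * (real j / real m)) * (e (real n * real (offset m P a) / real m) * e (real n * real b / real m))" for n
      unfolding e_add[symmetric] by (simp add: add_divide_distrib distrib_left add.assoc)
    thus "of_real (weight P a) * phase b * F (j + offset m P a + b)
       = (\<Sum>n\<in>I. v n * e (real n * (real j / real m)) * (?x n a * ?y n b))"
      unfolding F_def expsum_def sum_distrib_left by (intro sum.cong refl) (simp only: mult_ac)
  qed
  also have "\<dots> = (\<Sum>n\<in>I. \<Sum>(a, b)\<in>?A \<times> {..<W}. v n * e (real n * (real j / real m)) * (?x n a * ?y n b))"
    unfolding case_prod_unfold by (rule sum.swap)
  also have "\<dots> = (\<Sum>n\<in>I. v n * e (real n * (real j / real m)) * (of_real L * (of_nat W * \<kappa> n)))"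
  proof (rule sum.cong[OF refl])
    fix n assume n: "n \<in> I"
    have "(\<Sum>(a, b)\<in>?A \<times> {..<W}. v n * e (real n * (real j / real m)) * (?x n a * ?y n b))
        = v n * e (real n * (real j / real m)) * (\<Sum>(a, b)\<in>?A \<times> {..<W}. ?x n a * ?y n b)"
      by (simp only: sum_distrib_left case_prod_unfold)
    also have "(\<Sum>(a, b)\<in>?A \<times> {..<W}. ?x n a * ?y n b) = (\<Sum>a\<in>?A. ?x n a) * (\<Sum>b<W. ?y n b)"
      by (simp only: sum_product sum.cartesian_product)
    also have "(\<Sum>a\<in>?A. ?x n a) = of_real L"
      unfolding L_def using coprime_I[OF n] by (intro sum_weight_character finite_P prime_P m_pos dvd_m)
    also have "(\<Sum>b<W. ?y n b) = of_nat W * \<kappa> n"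
    proof -
      have "?y n b = e ((real n - n0) / real m * real b)" for b
        unfolding phase_def e_add[symmetric] by (simp add: diff_divide_distrib algebra_simps)
      thus ?thesis using W_pos by (simp add: \<kappa>_def)
    qed
    finally show "(\<Sum>(a, b)\<in>?A \<times> {..<W}. v n * e (real n * (real j / real m)) * (?x n a * ?y n b))
      = v n * e (real n * (real j / real m)) * (of_real L * (of_nat W * \<kappa> n))" .
  qed
  also have "\<dots> = (\<Sum>n\<in>I. of_real (L * real W) * (u n * e (real n * (real j / real m))))"
  proof (rule sum.cong[OF refl])
    fix n assume n: "n \<in> I"
    have "\<kappa> n \<noteq> 0" using norm_\<kappa>_ge[OF n] by auto
    thus "v n * e (real n * (real j / real m)) * (of_real L * (of_nat W * \<kappa> n))
        = of_real (L * real W) * (u n * e (real n * (real j / real m)))"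
      by (simp add: v_def)
  qed
  finally show ?thesis unfolding S_def expsum_def sum_distrib_left .
qed

lemma norm_phase [simp]: "norm (phase b) = 1"
  by (simp add: phase_def)

lemma mod_eq_obtains:
  fixes x y :: nat
  assumes "x mod m = y mod m"
  obtains k :: int where "real x - real y = of_int k * real m"
proof -
  have "int x mod int m = int y mod int m" using assms by (simp add: zmod_int[symmetric])
  hence "int m dvd int x - int y" by (simp add: mod_eq_dvd_iff)
  then obtain k where "int x - int y = int m * k" by auto
  hence "real_of_int (int x - int y) = real_of_int (int m * k)" by simp
  thus ?thesis using that[of k] by (simp add: mult.commute)
qed

lemma add_mod_cancel:
  fixes x b b' :: nat
  assumes "(x + b) mod m = (x + b') mod m" "b < m" "b' < m"
  shows "b = b'"
proof -
  have "int (x + b) mod int m = int (x + b') mod int m" using assms by (simp only: zmod_int[symmetric])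
  hence "int m dvd int b - int b'" by (simp add: mod_eq_dvd_iff)
  thus ?thesis using assms by (intro int_dvd_diff_less_imp_eq)
qed

lemma sum_weight_square_L: "(\<Sum>a\<in>shifts P Q. (weight P a)\<^sup>2) = L"
  unfolding L_def using finite_P prime_P by (rule sum_weight_square)

text \<open>
  Distinct fractions are at least \<open>1/Q\<^sup>2 \<ge> 1/N\<close> apart, so the windows around them are disjoint and the only
  coincidences between the evaluation points are trivial.
\<close>
lemma pointwise_bound:
  assumes Q: "Q * Q \<le> N"
  shows "L * (norm (S j))\<^sup>2 \<le> 3 * real N * B"
proof (cases "L = 0")
  case True
  thus ?thesis using B_nonneg by simp
next
  case False
  let ?X = "shifts P Q \<times> {..<W}"
  have finA: "finite (shifts P Q)" by (rule finite_shifts[OF finite_P])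
  let ?c = "\<lambda>(a, b). of_real (weight P a) * phase b"
  let ?y = "\<lambda>(a, b). j + offset m P a + b"
  have "(norm (\<Sum>x\<in>?X. ?c x * F (?y x)))\<^sup>2 \<le> (\<Sum>k<m. (norm (F k))\<^sup>2) *
      (\<Sum>x\<in>?X. \<Sum>x'\<in>?X. if ?y x mod m = ?y x' mod m then norm (?c x) * norm (?c x') else 0)"
    using finA by (intro norm_sum_translates_square_le m_pos F_mod) auto
  also have "(\<Sum>x\<in>?X. ?c x * F (?y x)) = of_real (L * real W) * S j"
    using reproducing_identity[of j] by (simp add: case_prod_unfold)
  also have "(\<Sum>x\<in>?X. \<Sum>x'\<in>?X. if ?y x mod m = ?y x' mod m then norm (?c x) * norm (?c x') else 0)
      = (\<Sum>x\<in>?X. (norm (?c x))\<^sup>2)"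
  proof (rule sum.cong[OF refl])
    fix x assume x: "x \<in> ?X"
    have inj: "x = x'" if x': "x' \<in> ?X" and eq: "?y x mod m = ?y x' mod m" for x'
    proof -
      obtain a b a' b' where xx: "x = (a, b)" "x' = (a', b')" by (cases x, cases x')
      have eq': "(j + offset m P a + b) mod m = (j + offset m P a' + b') mod m" using eq unfolding xx by simp
      from mod_eq_obtains[OF eq'] obtain k
        where "real (j + offset m P a + b) - real (j + offset m P a' + b') = of_int k * real m" .
      hence "real (offset m P a) - real (offset m P a') - of_int k * real m = real b' - real b" by simp
      hence "(real (offset m P a) - real (offset m P a') - of_int k * real m) / real m = (real b' - real b) / real m"
        by (simp only:)
      hence "real (offset m P a) / real m - real (offset m P a') / real m - of_int k = (real b' - real b) / real m"
        using m_pos by (simp add: diff_divide_distrib)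
      also have "\<bar>\<dots>\<bar> < real W / real m"
      proof -
        have "b < W" "b' < W" using x x' unfolding xx by auto
        hence "\<bar>real b' - real b\<bar> < real W" by linarith
        thus ?thesis using m_pos by (simp add: divide_strict_right_mono)
      qed
      also have "\<dots> = 1 / real N" using W_pos by (simp add: m_def)
      finally have "\<bar>real (offset m P a) / real m - real (offset m P a') / real m - of_int k\<bar> < 1 / real N" .
      also have "1 / real N \<le> 1 / real (Q * Q)"
      \<comment> \<open>The existence of a shift rules out \<open>Q = 0\<close>, for its denominator is at least 1.\<close>
      proof (cases "Q = 0")
        case True
        have "\<Prod>{p\<in>P. a p \<noteq> 0} > 0" by (rule prod_primes_pos) (use prime_P in auto)
        moreover have "\<Prod>{p\<in>P. a p \<noteq> 0} \<le> Q" by (rule shifts_support_le) (use x xx in simp)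
        ultimately show ?thesis using True by simp
      next
        case False
        have "real (Q * Q) \<le> real N" using Q by (simp only: of_nat_le_iff)
        thus ?thesis using False N_pos by (intro divide_left_mono) auto
      qed
      finally have "a = a'"
        using x x' unfolding xx by (intro shifts_separated[OF finite_P prime_P m_pos dvd_m]) auto
      moreover have "b = b'"
      proof (rule add_mod_cancel)
        show "(j + offset m P a + b) mod m = (j + offset m P a + b') mod m"
          using eq' unfolding \<open>a = a'\<close> .
        show "b < m" "b' < m" using x x' W_le_m unfolding xx by auto
      qed
      ultimately show ?thesis using xx by simp
    qed
    have "(\<Sum>x'\<in>?X. if ?y x mod m = ?y x' mod m then norm (?c x) * norm (?c x') else 0)
        = (\<Sum>x'\<in>{x}. if ?y x mod m = ?y x' mod m then norm (?c x) * norm (?c x') else 0)"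
      using x finA inj by (intro sum.mono_neutral_right) auto
    thus "(\<Sum>x'\<in>?X. if ?y x mod m = ?y x' mod m then norm (?c x) * norm (?c x') else 0) = (norm (?c x))\<^sup>2"
      by (simp add: power2_eq_square)
  qed
  also have "(\<Sum>x\<in>?X. (norm (?c x))\<^sup>2) = (\<Sum>a\<in>shifts P Q. \<Sum>b<W. (weight P a)\<^sup>2)"
    by (simp add: sum.cartesian_product case_prod_unfold norm_mult del: sum_constant)
  also have "\<dots> = L * real W" by (simp add: sum_distrib_left[symmetric] sum_weight_square_L mult.commute)
  finally have "(L * real W)\<^sup>2 * (norm (S j))\<^sup>2 \<le> (\<Sum>k<m. (norm (F k))\<^sup>2) * (L * real W)"
    using L_nonneg by (simp add: norm_mult power_mult_distrib)
  also have "\<dots> \<le> (3 * real m * B) * (L * real W)"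
    using L_nonneg by (intro mult_right_mono sum_norm_F_square_le) auto
  finally have "(L * (real W)\<^sup>2) * (L * (norm (S j))\<^sup>2) \<le> (L * (real W)\<^sup>2) * (3 * real N * B)"
    by (simp add: m_def power2_eq_square mult_ac)
  moreover have "L * (real W)\<^sup>2 > 0" using False L_nonneg W_pos by simp
  ultimately show ?thesis by (simp only: mult_le_cancel_left_pos)
qed

text \<open>
  Apply the duality step to \<open>\<Sum>\<^bsub>j \<in> E\<^esub> \<bar>S(j)\<bar>\<^sup>2\<close>, one factor \<open>S(j)\<close> being expressed by the reproducing identity. Coincidences
  are governed by two points \<open>j, j'\<close> of \<open>E\<close>, two fractions and two window positions. With equal fractions,
  every pair of window positions defines a partial injection of \<open>E\<close> into itself. With distinct fractions, \<open>j\<close> and \<open>j'\<close> determine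
  the difference of the fractions, as the windows are at most half as long as the separation \<open>1/Q\<^sup>4\<close>, so the
  correlation bound applies.
\<close>
lemma restriction_bound:
  assumes Q: "2 * Q ^ 4 \<le> N" and z: "z > 0" "\<And>p. p \<in> P \<Longrightarrow> z < p" and E: "E \<subseteq> {..<m}"
  shows "L * (\<Sum>j\<in>E. (norm (S j))\<^sup>2) \<le> 3 * real m * B * (1 + 3 * real (card E) / (real W * real z))"
proof -
  let ?A = "shifts P Q"
  let ?BW = "{..<W}"
  let ?X = "E \<times> (?A \<times> ?BW)"
  let ?c = "\<lambda>(j, a, b). cnj (S j) * (of_real (weight P a) * phase b)"
  let ?y = "\<lambda>(j, a, b). j + offset m P a + b"
  let ?w = "weight P"
  define s where "s j = norm (S j)" for j
  define X where "X = (\<Sum>j\<in>E. (s j)\<^sup>2)"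
  define C where "C jj aa bb \<longleftrightarrow> (fst jj + offset m P (fst aa) + fst bb) mod m = (snd jj + offset m P (snd aa) + snd bb) mod m" for jj aa bb
  define G where "G jj aa bb = (if C jj aa bb then s (fst jj) * s (snd jj) * (\<bar>?w (fst aa)\<bar> * \<bar>?w (snd aa)\<bar>) else 0)" for jj aa bb
  have finA: "finite ?A" by (rule finite_shifts[OF finite_P])
  have finE: "finite E" using E finite_subset by blast
  have s0: "s j \<ge> 0" for j by (simp add: s_def)
  have X0: "X \<ge> 0" unfolding X_def by (intro sum_nonneg) simp
  have G0: "G jj aa bb \<ge> 0" for jj aa bb by (simp add: G_def s0)
  \<comment> \<open>Duality, with the coincidences rearranged by pairs from \<open>E\<close>, pairs of fractions and pairs of window positions.\<close>
  have key: "(L * real W * X)\<^sup>2 \<le> (3 * real m * B) * (\<Sum>jj\<in>E \<times> E. \<Sum>aa\<in>?A \<times> ?A. \<Sum>bb\<in>?BW \<times> ?BW. G jj aa bb)"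
  proof -
    have "(\<Sum>x\<in>?X. ?c x * F (?y x)) = (\<Sum>j\<in>E. \<Sum>x\<in>?A \<times> ?BW. cnj (S j) * (of_real (?w (fst x)) * phase (snd x) * F (j + offset m P (fst x) + snd x)))"
      by (simp add: sum.cartesian_product case_prod_unfold mult.assoc)
    also have "\<dots> = (\<Sum>j\<in>E. cnj (S j) * (of_real (L * real W) * S j))"
      using reproducing_identity by (simp only: sum_distrib_left[symmetric] case_prod_unfold)
    also have "\<dots> = of_real (L * real W * X)"
      unfolding X_def s_def by (simp only: of_real_mult of_real_sum complex_norm_square sum_distrib_left) (simp add: mult_ac)
    finally have "norm (\<Sum>x\<in>?X. ?c x * F (?y x)) = \<bar>L * real W * X\<bar>"
      by (simp only: norm_of_real)
    hence "(L * real W * X)\<^sup>2 = (norm (\<Sum>x\<in>?X. ?c x * F (?y x)))\<^sup>2" by simp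
    also have "\<dots> \<le> (\<Sum>k<m. (norm (F k))\<^sup>2) *
        (\<Sum>x\<in>?X. \<Sum>x'\<in>?X. if ?y x mod m = ?y x' mod m then norm (?c x) * norm (?c x') else 0)"
      using finA finE by (intro norm_sum_translates_square_le m_pos F_mod) auto
    also have "\<dots> \<le> (3 * real m * B) *
        (\<Sum>x\<in>?X. \<Sum>x'\<in>?X. if ?y x mod m = ?y x' mod m then norm (?c x) * norm (?c x') else 0)"
      by (intro mult_right_mono sum_norm_F_square_le sum_nonneg) auto
    also have "(\<Sum>x\<in>?X. \<Sum>x'\<in>?X. if ?y x mod m = ?y x' mod m then norm (?c x) * norm (?c x') else 0)
      = (\<Sum>xx\<in>?X \<times> ?X. if ?y (fst xx) mod m = ?y (snd xx) mod m then norm (?c (fst xx)) * norm (?c (snd xx)) else 0)"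
      by (simp only: sum.cartesian_product case_prod_unfold)
    also have "\<dots> = (\<Sum>x\<in>(E \<times> E) \<times> ((?A \<times> ?A) \<times> (?BW \<times> ?BW)). G (fst x) (fst (snd x)) (snd (snd x)))"
      by (rule sum.reindex_bij_witness[of _
           "\<lambda>((j, j'), (a, a'), (b, b')). ((j, a, b), (j', a', b'))"
           "\<lambda>((j, a, b), (j', a', b')). ((j, j'), (a, a'), (b, b'))"])
         (auto simp: G_def C_def s_def norm_mult)
    also have "\<dots> = (\<Sum>jj\<in>E \<times> E. \<Sum>aa\<in>?A \<times> ?A. \<Sum>bb\<in>?BW \<times> ?BW. G jj aa bb)"
      by (simp only: sum.cartesian_product case_prod_unfold)
    finally show ?thesis .
  qed
  let ?D = "{aa \<in> ?A \<times> ?A. fst aa = snd aa}" and ?O = "{aa \<in> ?A \<times> ?A. fst aa \<noteq> snd aa}"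
  have split: "(\<Sum>aa\<in>?A \<times> ?A. g aa) = (\<Sum>aa\<in>?D. g aa) + (\<Sum>aa\<in>?O. g aa)" for g :: "_ \<Rightarrow> real"
  proof -
    have "(\<Sum>aa\<in>?A \<times> ?A. g aa) = (\<Sum>aa\<in>?D \<union> ?O. g aa)" by (rule sum.cong) auto
    also have "\<dots> = (\<Sum>aa\<in>?D. g aa) + (\<Sum>aa\<in>?O. g aa)" using finA by (intro sum.union_disjoint) auto
    finally show ?thesis .
  qed
  have diag: "(\<Sum>jj\<in>E \<times> E. \<Sum>aa\<in>?D. \<Sum>bb\<in>?BW \<times> ?BW. G jj aa bb) \<le> L * (real W)\<^sup>2 * X"
  proof -
    have "(\<Sum>jj\<in>E \<times> E. \<Sum>aa\<in>?D. \<Sum>bb\<in>?BW \<times> ?BW. G jj aa bb) = (\<Sum>aa\<in>?D. \<Sum>bb\<in>?BW \<times> ?BW. \<Sum>jj\<in>E \<times> E. G jj aa bb)"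
      by (subst sum.swap, rule sum.cong[OF refl], rule sum.swap)
    also have "\<dots> \<le> (\<Sum>aa\<in>?D. \<Sum>bb\<in>?BW \<times> ?BW. (?w (fst aa))\<^sup>2 * X)"
    proof (intro sum_mono)
      fix aa bb assume aa: "aa \<in> ?D"
      let ?R = "{jj \<in> E \<times> E. C jj aa bb}"
      have "(\<Sum>jj\<in>E \<times> E. G jj aa bb) = (\<Sum>jj\<in>?R. s (fst jj) * s (snd jj) * (\<bar>?w (fst aa)\<bar> * \<bar>?w (snd aa)\<bar>))"
        unfolding G_def using finE by (intro sum.inter_filter[symmetric]) auto
      also have "\<dots> = (?w (fst aa))\<^sup>2 * (\<Sum>jj\<in>?R. \<bar>s (fst jj)\<bar> * \<bar>s (snd jj)\<bar>)"
        using aa s0 by (simp add: sum_distrib_left mult_ac power2_eq_square)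
      also have "(\<Sum>jj\<in>?R. \<bar>s (fst jj)\<bar> * \<bar>s (snd jj)\<bar>) \<le> (1 * X + X / 1) / 2"
      proof (rule sum_pairs_le[OF finE finE])
        show "inj_on fst ?R"
        proof (rule inj_onI)
          fix x y assume xy: "x \<in> ?R" "y \<in> ?R" "fst x = fst y"
          have "(snd x + offset m P (snd aa) + snd bb) mod m = (snd y + offset m P (snd aa) + snd bb) mod m"
            using xy by (simp add: C_def)
          hence "(offset m P (snd aa) + snd bb + snd x) mod m = (offset m P (snd aa) + snd bb + snd y) mod m"
            by (simp only: add_ac)
          moreover have "snd x \<in> E" "snd y \<in> E" using xy(1,2) by (simp_all add: mem_Times_iff)
          hence "snd x < m" "snd y < m" using E by blast+
          ultimately have "snd x = snd y" by (rule add_mod_cancel)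
          thus "x = y" using xy by (simp add: prod_eq_iff)
        qed
        show "inj_on snd ?R"
        proof (rule inj_onI)
          fix x y assume xy: "x \<in> ?R" "y \<in> ?R" "snd x = snd y"
          have "(fst x + offset m P (fst aa) + fst bb) mod m = (fst y + offset m P (fst aa) + fst bb) mod m"
            using xy by (simp add: C_def)
          hence "(offset m P (fst aa) + fst bb + fst x) mod m = (offset m P (fst aa) + fst bb + fst y) mod m"
            by (simp only: add_ac)
          moreover have "fst x \<in> E" "fst y \<in> E" using xy(1,2) by (simp_all add: mem_Times_iff)
          hence "fst x < m" "fst y < m" using E by blast+
          ultimately have "fst x = fst y" by (rule add_mod_cancel)
          thus "x = y" using xy by (simp add: prod_eq_iff)
        qed
      qed (auto simp: X_def)
      finally show "(\<Sum>jj\<in>E \<times> E. G jj aa bb) \<le> (?w (fst aa))\<^sup>2 * X" by (simp add: mult_left_mono)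
    qed
    also have "\<dots> = (\<Sum>aa\<in>?D. (real W)\<^sup>2 * X * (?w (fst aa))\<^sup>2)"
      by (rule sum.cong[OF refl]) (simp add: power2_eq_square mult_ac)
    also have "\<dots> = (\<Sum>a\<in>?A. (real W)\<^sup>2 * X * (?w a)\<^sup>2)"
      by (rule sum.reindex_bij_witness[of _ "\<lambda>a. (a, a)" fst]) auto
    also have "\<dots> = L * (real W)\<^sup>2 * X" unfolding sum_distrib_left[symmetric] sum_weight_square_L by simp
    finally show ?thesis .
  qed
  have off: "(\<Sum>jj\<in>E \<times> E. \<Sum>aa\<in>?O. \<Sum>bb\<in>?BW \<times> ?BW. G jj aa bb) \<le> real W * (3 * L / real z) * (real (card E) * X)"
  proof -
    have "(\<Sum>aa\<in>?O. \<Sum>bb\<in>?BW \<times> ?BW. G jj aa bb) \<le> s (fst jj) * s (snd jj) * (real W * (3 * L / real z))" for jj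
    proof -
      let ?R = "{aa \<in> ?O. \<exists>bb\<in>?BW \<times> ?BW. C jj aa bb}"
      have "(\<Sum>aa\<in>?O. \<Sum>bb\<in>?BW \<times> ?BW. G jj aa bb) = (\<Sum>aa\<in>?R. \<Sum>bb\<in>?BW \<times> ?BW. G jj aa bb)"
        using finA by (intro sum.mono_neutral_right) (auto simp: G_def intro!: sum.neutral)
      also have "\<dots> \<le> (\<Sum>aa\<in>?R. real W * (s (fst jj) * s (snd jj)) * (\<bar>?w (fst aa)\<bar> * \<bar>?w (snd aa)\<bar>))"
      proof (rule sum_mono)
        fix aa
        let ?T = "{bb \<in> ?BW \<times> ?BW. C jj aa bb}"
        have "inj_on fst ?T"
        proof (rule inj_onI)
          fix x y assume xy: "x \<in> ?T" "y \<in> ?T" "fst x = fst y"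
          have "(snd jj + offset m P (snd aa) + snd x) mod m = (snd jj + offset m P (snd aa) + snd y) mod m"
            using xy by (simp add: C_def)
          moreover have "snd x < W" "snd y < W" using xy(1,2) by (simp_all add: mem_Times_iff)
          hence "snd x < m" "snd y < m" using W_le_m by simp_all
          ultimately have "snd x = snd y" by (rule add_mod_cancel)
          thus "x = y" using xy by (simp add: prod_eq_iff)
        qed
        hence "card ?T \<le> card ?BW" by (rule card_inj_on_le) auto
        hence T: "real (card ?T) \<le> real W" by simp
        have "(\<Sum>bb\<in>?BW \<times> ?BW. G jj aa bb) = (\<Sum>bb\<in>?T. s (fst jj) * s (snd jj) * (\<bar>?w (fst aa)\<bar> * \<bar>?w (snd aa)\<bar>))"
          unfolding G_def by (intro sum.inter_filter[symmetric]) auto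
        also have "\<dots> = real (card ?T) * (s (fst jj) * s (snd jj) * (\<bar>?w (fst aa)\<bar> * \<bar>?w (snd aa)\<bar>))" by simp
        also have "\<dots> \<le> real W * (s (fst jj) * s (snd jj) * (\<bar>?w (fst aa)\<bar> * \<bar>?w (snd aa)\<bar>))"
          using T s0 by (intro mult_right_mono) auto
        finally show "(\<Sum>bb\<in>?BW \<times> ?BW. G jj aa bb) \<le> real W * (s (fst jj) * s (snd jj)) * (\<bar>?w (fst aa)\<bar> * \<bar>?w (snd aa)\<bar>)"
          by (simp only: mult.assoc)
      qed
      also have "\<dots> = real W * (s (fst jj) * s (snd jj)) * (\<Sum>aa\<in>?R. \<bar>?w (fst aa)\<bar> * \<bar>?w (snd aa)\<bar>)"
        by (simp only: sum_distrib_left)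
      also have "\<dots> \<le> real W * (s (fst jj) * s (snd jj)) * (3 * L / real z)"
      proof (rule mult_left_mono)
        show "(\<Sum>aa\<in>?R. \<bar>?w (fst aa)\<bar> * \<bar>?w (snd aa)\<bar>) \<le> 3 * L / real z"
          unfolding L_def
        proof (rule weight_correlation_le[OF finite_P prime_P z(2) z(1)])
          show "?R \<subseteq> ?A \<times> ?A" by auto
          show "a \<noteq> a'" if "(a, a') \<in> ?R" for a a' using that by auto
          fix a a' c c' p
          assume aa: "(a, a') \<in> ?R" and cc: "(c, c') \<in> ?R" and p: "p \<in> P"
          from aa obtain b b' where b: "b < W" "b' < W" "C jj (a, a') (b, b')" by auto
          from cc obtain d d' where d: "d < W" "d' < W" "C jj (c, c') (d, d')" by auto
          obtain k1 where k1: "real (fst jj + offset m P a + b) - real (snd jj + offset m P a' + b') = of_int k1 * real m"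
            using mod_eq_obtains[OF b(3)[unfolded C_def fst_conv snd_conv]] .
          obtain k2 where k2: "real (fst jj + offset m P c + d) - real (snd jj + offset m P c' + d') = of_int k2 * real m"
            using mod_eq_obtains[OF d(3)[unfolded C_def fst_conv snd_conv]] .
          let ?num = "real (offset m P a) - real (offset m P a') - real (offset m P c) + real (offset m P c')"
          have "?num - of_int (k1 - k2) * real m = (real b' - real b) + (real d - real d')"
            using k1 k2 by (simp add: algebra_simps)
          hence "(?num - of_int (k1 - k2) * real m) / real m = ((real b' - real b) + (real d - real d')) / real m"
            by (simp only:)
          hence eq: "?num / real m - of_int (k1 - k2) = ((real b' - real b) + (real d - real d')) / real m"
            using m_pos by (simp only: diff_divide_distrib) simp
          have "\<bar>(real b' - real b) + (real d - real d')\<bar> < 2 * real W" using b d by linarith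
          hence "\<bar>((real b' - real b) + (real d - real d')) / real m\<bar> < 2 * real W / real m"
            using m_pos by (simp add: divide_strict_right_mono)
          also have "\<dots> = 2 / real N" using W_pos by (simp add: m_def)
          also have "\<dots> \<le> 1 / real (Q ^ 4)"
          proof -
            have "\<Prod>{p\<in>P. a p \<noteq> 0} > 0" by (rule prod_primes_pos) (use prime_P in auto)
            moreover have "\<Prod>{p\<in>P. a p \<noteq> 0} \<le> Q" by (rule shifts_support_le) (use aa in simp)
            ultimately have "real (Q ^ 4) > 0" by simp
            moreover have "real (2 * Q ^ 4) \<le> real N" using Q by (simp only: of_nat_le_iff)
            ultimately show ?thesis using N_pos by (simp add: field_simps)
          qed
          finally have "\<bar>?num / real m - of_int (k1 - k2)\<bar> < 1 / real (Q ^ 4)" unfolding eq .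
          moreover have "a \<in> ?A" "a' \<in> ?A" "c \<in> ?A" "c' \<in> ?A" using aa cc by auto
          ultimately show "int p dvd (int (a p) - int (a' p)) - (int (c p) - int (c' p))"
            using shift_differences_separated[OF finite_P prime_P m_pos dvd_m _ _ _ _ _ p] by blast
        qed
      qed (use s0 in auto)
      finally show ?thesis by (simp only: mult_ac)
    qed
    hence "(\<Sum>jj\<in>E \<times> E. \<Sum>aa\<in>?O. \<Sum>bb\<in>?BW \<times> ?BW. G jj aa bb) \<le> (\<Sum>jj\<in>E \<times> E. s (fst jj) * s (snd jj) * (real W * (3 * L / real z)))"
      by (intro sum_mono)
    also have "\<dots> = real W * (3 * L / real z) * (\<Sum>jj\<in>E \<times> E. s (fst jj) * s (snd jj))"
      by (simp only: sum_distrib_left mult_ac)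
    also have "(\<Sum>jj\<in>E \<times> E. s (fst jj) * s (snd jj)) = (\<Sum>j\<in>E. 1 * s j)\<^sup>2"
      by (simp add: power2_eq_square sum_product sum.cartesian_product case_prod_unfold)
    also have "real W * (3 * L / real z) * (\<Sum>j\<in>E. 1 * s j)\<^sup>2 \<le> real W * (3 * L / real z) * (real (card E) * X)"
    proof (rule mult_left_mono)
      have "(\<Sum>j\<in>E. 1 * s j)\<^sup>2 \<le> (\<Sum>j\<in>E. 1\<^sup>2) * (\<Sum>j\<in>E. (s j)\<^sup>2)" by (rule Cauchy_Schwarz_ineq_sum)
      thus "(\<Sum>j\<in>E. 1 * s j)\<^sup>2 \<le> real (card E) * X" by (simp add: X_def)
    qed (use L_nonneg in simp)
    finally show ?thesis .
  qed
  have "(L * real W * X)\<^sup>2 \<le> (3 * real m * B) * (L * (real W)\<^sup>2 * X + real W * (3 * L / real z) * (real (card E) * X))"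
  proof (rule order_trans[OF key mult_left_mono])
    show "(\<Sum>jj\<in>E \<times> E. \<Sum>aa\<in>?A \<times> ?A. \<Sum>bb\<in>?BW \<times> ?BW. G jj aa bb)
      \<le> L * (real W)\<^sup>2 * X + real W * (3 * L / real z) * (real (card E) * X)"
      unfolding split sum.distrib by (rule add_mono[OF diag off])
  qed (use B_nonneg in simp)
  also have "\<dots> = (L * (real W)\<^sup>2 * X) * (3 * real m * B * (1 + 3 * real (card E) / (real W * real z)))"
    using W_pos z by (simp add: field_simps power2_eq_square)
  finally have fin: "(L * (real W)\<^sup>2 * X) * (L * X) \<le> (L * (real W)\<^sup>2 * X) * (3 * real m * B * (1 + 3 * real (card E) / (real W * real z)))"
    by (simp add: power2_eq_square mult_ac)
  show ?thesis
  proof (cases "L * X = 0")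
    case True
    have "L * (\<Sum>j\<in>E. (norm (S j))\<^sup>2) = 0" using True unfolding X_def s_def .
    also have "0 \<le> 3 * real m * B * (1 + 3 * real (card E) / (real W * real z))"
      using B_nonneg by (intro mult_nonneg_nonneg) auto
    finally show ?thesis .
  next
    case False
    hence "L > 0" "X > 0" using L_nonneg X0 by (auto simp: less_le)
    hence "L * (real W)\<^sup>2 * X > 0" using W_pos by simp
    hence "L * X \<le> 3 * real m * B * (1 + 3 * real (card E) / (real W * real z))"
      using fin by (simp only: mult_le_cancel_left_pos)
    thus ?thesis unfolding X_def s_def .
  qed
qed

end

section \<open>Primes in an interval: supremum and level sets\<close>

lemma norm_sum_square_le_two_parts:
  fixes x y :: complex
  assumes "(norm x)\<^sup>2 \<le> \<alpha> * b" "(norm y)\<^sup>2 \<le> \<beta> * c" "\<alpha> \<ge> 0" "\<beta> \<ge> 0" "b \<ge> 0" "c \<ge> 0"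
  shows "(norm (x + y))\<^sup>2 \<le> (\<alpha> + \<beta>) * (b + c)"
proof -
  have "(norm x * norm y)\<^sup>2 \<le> (\<alpha> * b) * (\<beta> * c)"
    unfolding power_mult_distrib using assms by (intro mult_mono) auto
  also have "\<dots> = (\<alpha> * c) * (\<beta> * b)" by simp
  finally have "4 * (norm x * norm y)\<^sup>2 \<le> 4 * ((\<alpha> * c) * (\<beta> * b))" by simp
  also have "\<dots> \<le> (\<alpha> * c + \<beta> * b)\<^sup>2"
    using zero_le_power2[of "\<alpha> * c - \<beta> * b"] by (simp add: power2_eq_square algebra_simps)
  finally have "(2 * (norm x * norm y))\<^sup>2 \<le> (\<alpha> * c + \<beta> * b)\<^sup>2"
    by (simp add: power_mult_distrib)
  hence xy: "2 * (norm x * norm y) \<le> \<alpha> * c + \<beta> * b"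
    by (rule power2_le_imp_le) (use assms in simp)
  have "(norm (x + y))\<^sup>2 \<le> (norm x + norm y)\<^sup>2"
    by (intro power_mono norm_triangle_ineq) auto
  also have "\<dots> = (norm x)\<^sup>2 + (norm y)\<^sup>2 + 2 * (norm x * norm y)"
    by (simp add: power2_eq_square algebra_simps)
  also have "\<dots> \<le> \<alpha> * b + \<beta> * c + (\<alpha> * c + \<beta> * b)" using assms xy by linarith
  finally show ?thesis by (simp add: algebra_simps)
qed

lemma norm_expsum_square_le_card:
  "(norm (expsum I v x))\<^sup>2 \<le> real (card I) * (\<Sum>n\<in>I. (norm (v n))\<^sup>2)"
proof -
  have "norm (expsum I v x) \<le> (\<Sum>n\<in>I. norm (v n * e (real n * x)))"
    unfolding expsum_def by (rule norm_sum)
  also have "\<dots> = (\<Sum>n\<in>I. 1 * norm (v n))" by (simp add: norm_mult)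
  finally have "(norm (expsum I v x))\<^sup>2 \<le> (\<Sum>n\<in>I. 1 * norm (v n))\<^sup>2" by (intro power_mono) auto
  also have "\<dots> \<le> (\<Sum>n\<in>I. 1\<^sup>2) * (\<Sum>n\<in>I. (norm (v n))\<^sup>2)" by (rule Cauchy_Schwarz_ineq_sum)
  finally show ?thesis by simp
qed

text \<open>
  Integer parts of roots; it is applied to \<open>q\<^sup>2\<close> and to \<open>2q\<^sup>4\<close>.
\<close>
lemma between_successive_values:
  fixes f :: "nat \<Rightarrow> nat"
  assumes "f 0 \<le> n" and "n < f (Suc n)"
  obtains Q where "f Q \<le> n" "n < f (Suc Q)"
proof -
  define Q where "Q = (LEAST q. n < f (Suc q))"
  have 1: "n < f (Suc Q)" unfolding Q_def by (rule LeastI[of _ n]) fact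
  have "f Q \<le> n"
  proof (cases Q)
    case (Suc q)
    hence "\<not> n < f (Suc q)" unfolding Q_def by (intro not_less_Least) simp
    thus ?thesis using Suc by simp
  qed (use assms in simp)
  thus ?thesis using that 1 by blast
qed

text \<open>
  The sum over primes in \<open>[M + 1, M + N]\<close>, sampled at the multiples of \<open>1/m\<close>. Here \<open>N'\<close> is the integer part of
  \<open>N\<close>; it still exceeds \<open>N - 1\<close>, which bounds the differences of two primes in the interval.
\<close>
locale prime_interval =
  fixes N M :: real and u :: "nat \<Rightarrow> complex"
  assumes N_ge: "N \<ge> 1000"
begin

definition "N' = nat \<lfloor>N\<rfloor>"
definition "W = \<Prod>{p. prime p \<and> p \<le> N'}"
definition "m = N' * W"
definition "J = primes_between (M + 1) (M + N)"
definition "B = (\<Sum>p\<in>J. (norm (u p))\<^sup>2)"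
definition "X = 2 * N / ln N * B"
definition "S j = expsum J u (real j / real m)"

lemma N'_bounds: "real N' \<le> N" "N < real N' + 1" "N' \<ge> 1000"
proof -
  have "\<lfloor>N\<rfloor> \<ge> 1000" using N_ge by (simp add: le_floor_iff)
  thus "real N' \<le> N" "N < real N' + 1" "N' \<ge> 1000" unfolding N'_def by linarith+
qed

lemma lnN_pos: "ln N > 0" using N_ge by simp

lemma W_pos: "W > 0" unfolding W_def by (rule prod_primes_pos) auto

lemma m_pos: "m > 0" using W_pos N'_bounds by (simp add: m_def)

lemma finite_J: "finite J"
proof (rule finite_subset)
  show "J \<subseteq> {..nat \<lfloor>M + N\<rfloor>}" unfolding J_def primes_between_def
    by (auto simp: le_nat_floor)
qed simp

lemma J_D: "n \<in> J \<Longrightarrow> prime n" "n \<in> J \<Longrightarrow> M + 1 \<le> real n" "n \<in> J \<Longrightarrow> real n \<le> M + N"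
  unfolding J_def primes_between_def by auto

lemma J_spread: "n \<in> J \<Longrightarrow> n' \<in> J \<Longrightarrow> n < n' \<Longrightarrow> n' - n < N'"
  using J_D(2)[of n] J_D(3)[of n'] N'_bounds by linarith

lemma B_nonneg: "B \<ge> 0" unfolding B_def by (intro sum_nonneg) simp

lemma X_nonneg: "X \<ge> 0" unfolding X_def using B_nonneg lnN_pos N_ge by simp

lemma N_mult_B: "N * B = X * ln N / 2"
  unfolding X_def using lnN_pos by simp

lemma parseval: "(\<Sum>j<m. (norm (S j))\<^sup>2) = real m * B"
  unfolding S_def B_def
proof (rule sum_norm_expsum_square[OF m_pos finite_J])
  fix n n' assume "n \<in> J" "n' \<in> J" "n < n'"
  hence "n' - n < N'" by (rule J_spread)
  also have "N' \<le> m" using W_pos by (simp add: m_def)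
  finally show "n' - n < m" .
qed

text \<open>
  The sieve identity holds for primes greater than \<open>Q\<close> only. The others occur if \<open>M < Q\<close>; there are at
  most \<open>Q\<close> of them, which is negligible.
\<close>
definition "large Q = {n \<in> J. Q < n}"
definition "small Q = {n \<in> J. n \<le> Q}"
definition "S_large Q j = expsum (large Q) u (real j / real m)"
definition "S_small Q j = expsum (small Q) u (real j / real m)"
definition "B_large Q = (\<Sum>n\<in>large Q. (norm (u n))\<^sup>2)"
definition "B_small Q = (\<Sum>n\<in>small Q. (norm (u n))\<^sup>2)"
definition "sieving_primes z Q = {p::nat. prime p \<and> z < p \<and> p \<le> Q}"

lemma split_sum: "(\<Sum>n\<in>J. f n) = (\<Sum>n\<in>large Q. f n) + (\<Sum>n\<in>small Q. f n)"
proof -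
  have "J = large Q \<union> small Q" unfolding large_def small_def by auto
  moreover have "(\<Sum>n\<in>large Q \<union> small Q. f n) = (\<Sum>n\<in>large Q. f n) + (\<Sum>n\<in>small Q. f n)"
    using finite_J by (intro sum.union_disjoint) (auto simp: large_def small_def)
  ultimately show ?thesis by simp
qed

lemma S_split: "S j = S_large Q j + S_small Q j"
  unfolding S_def S_large_def S_small_def expsum_def by (rule split_sum)

lemma B_split: "B = B_large Q + B_small Q"
  unfolding B_def B_large_def B_small_def by (rule split_sum)

lemma B_large_nonneg: "B_large Q \<ge> 0" and B_small_nonneg: "B_small Q \<ge> 0"
  unfolding B_large_def B_small_def by (auto intro: sum_nonneg)

lemma norm_S_small_le: "(norm (S_small Q j))\<^sup>2 \<le> real Q * B_small Q"
proof -
  have "small Q \<subseteq> {1..Q}" unfolding small_def using J_D(1) prime_ge_1_nat by auto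
  hence "card (small Q) \<le> card {1..Q}" by (intro card_mono) auto
  hence "real (card (small Q)) * B_small Q \<le> real Q * B_small Q"
    by (intro mult_right_mono B_small_nonneg) simp
  thus ?thesis unfolding S_small_def B_small_def
    using norm_expsum_square_le_card[of "small Q" u "real j / real m"] by linarith
qed

lemma sieved_sum_large:
  assumes "Q \<le> N'"
  shows "sieved_sum (sieving_primes z Q) (large Q) N' W (M + (N + 1) / 2)"
proof
  show "finite (sieving_primes z Q)" by (rule finite_subset[of _ "{..Q}"]) (auto simp: sieving_primes_def)
  show "prime p" if "p \<in> sieving_primes z Q" for p using that by (simp add: sieving_primes_def)
  show "p dvd W" if "p \<in> sieving_primes z Q" for p
    unfolding W_def using that assms by (intro dvd_prodI) (auto simp: sieving_primes_def)
  show "W > 0" "N' > 0" using W_pos N'_bounds by auto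
  show "finite (large Q)" using finite_J by (simp add: large_def)
  show "\<not> p dvd n" if "n \<in> large Q" "p \<in> sieving_primes z Q" for n p
  proof
    assume "p dvd n"
    hence "p = n" using that J_D(1)[of n] by (intro primes_dvd_imp_eq) (auto simp: large_def sieving_primes_def)
    thus False using that by (simp add: large_def sieving_primes_def)
  qed
  show "\<bar>real n - (M + (N + 1) / 2)\<bar> \<le> real N' / 2" if "n \<in> large Q" for n
  proof -
    have "n \<in> J" using that by (simp add: large_def)
    hence "M + 1 \<le> real n" "real n \<le> M + N" using J_D by auto
    thus ?thesis using N'_bounds unfolding abs_le_iff by (simp add: field_simps)
  qed
  show "n' - n < N'" if "n \<in> large Q" "n' \<in> large Q" "n < n'" for n n'
    using that J_spread by (simp add: large_def)
qed

lemma pointwise_bound_large: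
  assumes "Q \<le> N'" "Q * Q \<le> N'"
  shows "sieve_mass (sieving_primes z Q) Q * (norm (S_large Q j))\<^sup>2 \<le> 3 * real N' * B_large Q"
proof -
  interpret sv: sieved_sum "sieving_primes z Q" "large Q" Q N' W "M + (N + 1) / 2" u
    by (rule sieved_sum_large[OF assms(1)])
  show ?thesis using sv.pointwise_bound[OF assms(2), of j]
    unfolding sv.L_def sv.S_def sv.B_def sv.m_def S_large_def B_large_def m_def .
qed

lemma restriction_bound_large:
  assumes "Q \<le> N'" "2 * Q ^ 4 \<le> N'" "z > 0" "E \<subseteq> {..<m}"
  shows "sieve_mass (sieving_primes z Q) Q * (\<Sum>j\<in>E. (norm (S_large Q j))\<^sup>2)
         \<le> 3 * real m * B_large Q * (1 + 3 * real (card E) / (real W * real z))"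
proof -
  interpret sv: sieved_sum "sieving_primes z Q" "large Q" Q N' W "M + (N + 1) / 2" u
    by (rule sieved_sum_large[OF assms(1)])
  have zp: "z < p" if "p \<in> sieving_primes z Q" for p using that by (simp add: sieving_primes_def)
  have "E \<subseteq> {..<sv.m}" using assms(4) unfolding sv.m_def m_def .
  from sv.restriction_bound[OF assms(2,3) zp this] show ?thesis
    unfolding sv.L_def sv.S_def sv.B_def sv.m_def S_large_def B_large_def m_def .
qed

text \<open>
  The constant is \<open>6 + 2 = 8\<close> times \<open>N B / ln N\<close>: large primes contribute \<open>3N / L\<close> with \<open>L \<ge> ln N / 2\<close>, small
  ones \<open>Q \<le> \<surd>N \<le> 2N / ln N\<close>. The value \<open>4X\<close> matters, since its power \<open>h/2\<close> must not exceed a multiple of \<open>2\<^sup>h\<close>.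
\<close>
lemma norm_S_square_le: "(norm (S j))\<^sup>2 \<le> 4 * X"
proof -
  obtain Q where Q: "Q * Q \<le> N'" "N' < Suc Q * Suc Q"
    by (rule between_successive_values[of "\<lambda>q. q * q" N']) auto
  have QN: "Q \<le> N'" using Q(1) le_square[of Q] by linarith
  have "N \<le> real (N' + 1)" using N'_bounds by simp
  also have "\<dots> \<le> real (Suc Q * Suc Q)" using Q by (simp only: of_nat_le_iff)
  also have "\<dots> = (real Q + 1)\<^sup>2" by (simp add: power2_eq_square algebra_simps)
  finally have "ln N \<le> ln ((real Q + 1)\<^sup>2)" using N_ge by (intro ln_mono) auto
  hence "ln N / 2 \<le> ln (real Q + 1)" by (simp add: ln_realpow)
  also have "\<dots> \<le> sieve_mass (sieving_primes 1 Q) Q"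
    using ln_le_euler_factor_mult_sieve_mass[of Q 1] by (simp only: euler_factor_1 sieving_primes_def mult_1)
  finally have "ln N / 2 * (norm (S_large Q j))\<^sup>2 \<le> sieve_mass (sieving_primes 1 Q) Q * (norm (S_large Q j))\<^sup>2"
    by (intro mult_right_mono) auto
  also have "\<dots> \<le> 3 * real N' * B_large Q" by (rule pointwise_bound_large[OF QN Q(1)])
  also have "\<dots> \<le> 3 * N * B_large Q" using N'_bounds B_large_nonneg by (intro mult_right_mono) auto
  finally have l: "(norm (S_large Q j))\<^sup>2 \<le> (6 * N / ln N) * B_large Q"
    using lnN_pos by (simp add: pos_le_divide_eq mult_ac)
  have "real Q \<le> sqrt N"
  proof (rule real_le_rsqrt)
    have "real (Q * Q) \<le> real N'" using Q by (simp only: of_nat_le_iff)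
    thus "(real Q)\<^sup>2 \<le> N" using N'_bounds by (simp add: power2_eq_square)
  qed
  also have "sqrt N \<le> 2 * N / ln N"
  proof -
    have "ln (sqrt N) \<le> sqrt N - 1" using N_ge by (intro ln_le_minus_one) auto
    hence "ln N \<le> 2 * sqrt N" using N_ge by (simp add: ln_sqrt)
    hence "sqrt N * ln N \<le> sqrt N * (2 * sqrt N)" using N_ge by (intro mult_left_mono) auto
    also have "\<dots> = 2 * N" using N_ge by simp
    finally show ?thesis using lnN_pos by (simp add: pos_le_divide_eq)
  qed
  finally have "real Q * B_small Q \<le> 2 * N / ln N * B_small Q" by (intro mult_right_mono B_small_nonneg)
  hence s: "(norm (S_small Q j))\<^sup>2 \<le> (2 * N / ln N) * B_small Q"
    using norm_S_small_le[of Q j] by linarith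
  have "(norm (S j))\<^sup>2 \<le> (6 * N / ln N + 2 * N / ln N) * (B_large Q + B_small Q)"
    unfolding S_split[of j Q]
    by (rule norm_sum_square_le_two_parts[OF l s]) (use N_ge lnN_pos B_large_nonneg B_small_nonneg in auto)
  also have "\<dots> = 4 * X" unfolding X_def B_split[of Q] by (simp add: add_divide_distrib[symmetric])
  finally show ?thesis .
qed

text \<open>
  If \<open>ln N / 2\<close> is below the claimed factor, Parseval's identity is enough. Otherwise \<open>N\<close> is so large that
  \<open>4\<^sup>i \<le> N\<^bsup>1/4\<^esup>\<close>. Let \<open>G\<close> be the sum on the left. By definition of the level set, \<open>card E \<sqdot> X \<le> 4\<^sup>i G\<close>, so both the
  off-diagonal term of the restriction bound and the contribution of the small primes are small
  multiples of \<open>G\<close> and can be absorbed. This needs \<open>z\<close> a little larger than \<open>4\<^sup>i ln z\<close>, whence \<open>z = 2\<^bsup>15\<^esup> 8\<^sup>i\<close>.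
\<close>
lemma sum_level_set_le:
  fixes i :: nat
  defines "E \<equiv> {j. j < m \<and> X / 4 ^ i < (norm (S j))\<^sup>2}"
  shows "N * (\<Sum>j\<in>E. (norm (S j))\<^sup>2) \<le> (5200 + 1020 * real i) * X * real m"
proof (cases "ln N / 2 \<le> 5200 + 1020 * real i")
  case True
  have "N * (\<Sum>j\<in>E. (norm (S j))\<^sup>2) \<le> N * (\<Sum>j<m. (norm (S j))\<^sup>2)"
    using N_ge by (intro mult_left_mono sum_mono2) (auto simp: E_def)
  also have "\<dots> = real m * (N * B)" unfolding parseval by simp
  also have "\<dots> = ln N / 2 * (X * real m)" unfolding N_mult_B by simp
  also have "\<dots> \<le> (5200 + 1020 * real i) * (X * real m)"
    using True X_nonneg by (intro mult_right_mono) auto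
  finally show ?thesis by (simp only: mult.assoc)
next
  case False
  define y where "y = ln N"
  have y: "y > 10400 + 2040 * real i" using False unfolding y_def by simp
  have Ny: "N = exp y" unfolding y_def using N_ge by simp
  define G where "G = (\<Sum>j\<in>E. (norm (S j))\<^sup>2)"
  define z :: nat where "z = 2 ^ (15 + 3 * i)"
  define V where "V = euler_factor z"
  obtain Q where Q: "2 * Q ^ 4 \<le> N'" "N' < 2 * Suc Q ^ 4"
  proof (rule between_successive_values[of "\<lambda>q. 2 * q ^ 4" N'])
    have "Suc N' ^ 1 \<le> Suc N' ^ 4" by (rule power_increasing) auto
    thus "N' < 2 * Suc N' ^ 4" by (simp only: power_one_right)
  qed auto
  have QN: "Q \<le> N'"
  proof (cases "Q = 0")
    case False
    hence "Q ^ 1 \<le> Q ^ 4" by (intro power_increasing) auto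
    thus ?thesis using Q by simp
  qed simp
  have EM: "E \<subseteq> {..<m}" unfolding E_def by auto
  have G0: "G \<ge> 0" unfolding G_def by (intro sum_nonneg) simp
  have cardE: "real (card E) * X \<le> 4 ^ i * G"
  proof -
    have "real (card E) * (X / 4 ^ i) = (\<Sum>j\<in>E. X / 4 ^ i)" by simp
    also have "\<dots> \<le> G" unfolding G_def by (rule sum_mono) (auto simp: E_def)
    finally show ?thesis by (simp add: field_simps)
  qed
  have V: "0 \<le> V" "V \<le> 171 + 34 * real i"
  proof -
    show "0 \<le> V" unfolding V_def by (rule euler_factor_nonneg)
    have "2 ^ 1 \<le> z" unfolding z_def by (rule power_increasing) auto
    hence "V \<le> 4 + 16 * ln (real z)" unfolding V_def by (intro euler_factor_le) simp
    also have "ln (real z) = (15 + 3 * real i) * ln 2" unfolding z_def by (simp add: ln_realpow)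
    also have "4 + 16 * ((15 + 3 * real i) * ln 2) \<le> 4 + 16 * ((15 + 3 * real i) * (25 / 36))"
      by (intro add_left_mono mult_left_mono ln2_le_25_over_36) auto
    finally show "V \<le> 171 + 34 * real i" by (simp add: field_simps)
  qed
  have z0: "z > 0" by (simp add: z_def)
  \<comment> \<open>The choice of \<open>z\<close>: \<open>180 V \<le> 30780 + 6120 i \<le> 2\<^bsup>15\<^esup> (1 + i) \<le> 2\<^bsup>15\<^esup> 2\<^sup>i\<close>.\<close>
  have Vz: "V * (4 ^ i / real z) \<le> 1 / 180"
  proof -
    have "1 + real i \<le> 2 ^ i" by (induction i) auto
    hence "180 * (171 + 34 * real i) \<le> 2 ^ 15 * (2 ^ i :: real)" by simp
    moreover have "180 * V \<le> 180 * (171 + 34 * real i)" using V by simp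
    ultimately have "180 * V \<le> 2 ^ 15 * 2 ^ i" by (rule order_trans[rotated])
    hence "180 * V * 4 ^ i \<le> 2 ^ 15 * 2 ^ i * 4 ^ i" by (intro mult_right_mono) auto
    also have "\<dots> = 2 ^ 15 * (2 * 4) ^ i" by (simp only: power_mult_distrib mult.assoc)
    also have "\<dots> = real z" by (simp add: z_def power_add power_mult)
    finally show ?thesis using z0 by (simp add: field_simps)
  qed
  \<comment> \<open>Here \<open>4\<^sup>i\<close> and \<open>Q\<close> are at most \<open>N\<^bsup>1/4\<^esup>\<close>, while \<open>4 ln N \<le> N\<^bsup>1/2\<^esup>\<close>.\<close>
  have Qy: "4 ^ i * real Q * y \<le> N / 4"
  proof -
    have "(2::real) \<le> exp 1" using exp_ge_add_one_self[of 1] by simp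
    hence "2 * 2 \<le> exp 1 * exp (1::real)" by (intro mult_mono) auto
    hence "4 \<le> exp (2::real)" by (simp add: mult_exp_exp)
    hence "4 ^ i \<le> exp (2::real) ^ i" by (intro power_mono) auto
    also have "\<dots> = exp (2 * real i)" by (simp add: exp_of_nat_mult[symmetric] mult.commute)
    also have "\<dots> \<le> exp (y / 4)" using y by simp
    finally have 1: "4 ^ i \<le> exp (y / 4)" .
    have "real (2 * Q ^ 4) \<le> real N'" using Q by (simp only: of_nat_le_iff)
    hence "real Q ^ 4 \<le> N" using N'_bounds by simp
    also have "N = exp (y / 4) ^ 4" unfolding Ny by (simp add: exp_of_nat_mult[symmetric])
    finally have 2: "real Q \<le> exp (y / 4)" by (rule power_le_imp_le_base[where n = 3, simplified]) simp
    have "y / 4 \<le> exp (y / 4)" using exp_ge_add_one_self[of "y / 4"] by linarith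
    hence "(y / 4) * (y / 4) \<le> exp (y / 4) * exp (y / 4)" using y by (intro mult_mono) auto
    hence "y * y \<le> 16 * exp (y / 2)" by (simp add: mult_exp_exp)
    moreover have "64 * y \<le> y * y" using y by (intro mult_right_mono) auto
    ultimately have 3: "4 * y \<le> exp (y / 2)" by linarith
    have "4 ^ i * real Q * (4 * y) \<le> exp (y / 4) * exp (y / 4) * exp (y / 2)"
      using 1 2 3 y by (intro mult_mono) auto
    also have "\<dots> = N" unfolding Ny by (simp add: mult_exp_exp)
    finally show ?thesis by simp
  qed
  define GL where "GL = (\<Sum>j\<in>E. (norm (S_large Q j))\<^sup>2)"
  define GS where "GS = (\<Sum>j\<in>E. (norm (S_small Q j))\<^sup>2)"
  have GL0: "GL \<ge> 0" unfolding GL_def by (intro sum_nonneg) simp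
  have GG: "G \<le> 2 * GL + 2 * GS"
  proof -
    have "(norm (S j))\<^sup>2 \<le> 2 * (norm (S_large Q j))\<^sup>2 + 2 * (norm (S_small Q j))\<^sup>2" for j
    proof -
      have "(norm (S j))\<^sup>2 \<le> (norm (S_large Q j) + norm (S_small Q j))\<^sup>2"
        unfolding S_split[of j Q] by (intro power_mono norm_triangle_ineq) auto
      also have "\<dots> \<le> 2 * (norm (S_large Q j))\<^sup>2 + 2 * (norm (S_small Q j))\<^sup>2"
        using zero_le_power2[of "norm (S_large Q j) - norm (S_small Q j)"]
        by (simp add: power2_eq_square algebra_simps)
      finally show ?thesis .
    qed
    hence "G \<le> (\<Sum>j\<in>E. 2 * (norm (S_large Q j))\<^sup>2 + 2 * (norm (S_small Q j))\<^sup>2)"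
      unfolding G_def by (rule sum_mono)
    thus ?thesis unfolding GL_def GS_def by (simp add: sum.distrib sum_distrib_left)
  qed
  have large: "N * GL \<le> 15 / 2 * V * X * real m + N * G / 8"
  proof -
    define L where "L = sieve_mass (sieving_primes z Q) Q"
    let ?T = "1 + 3 * real (card E) / (real W * real z)"
    have "N \<le> real (N' + 1)" using N'_bounds by simp
    also have "\<dots> \<le> real (2 * Suc Q ^ 4)" using Q by (simp only: of_nat_le_iff)
    also have "\<dots> = 2 * (real Q + 1) ^ 4" by (simp add: add.commute)
    finally have "ln N \<le> ln (2 * (real Q + 1) ^ 4)" using N_ge by (intro ln_mono) auto
    also have "\<dots> = ln 2 + 4 * ln (real Q + 1)" by (simp add: ln_mult ln_realpow)
    finally have "y / 5 \<le> ln (real Q + 1)" using y ln2_le_25_over_36 unfolding y_def by linarith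
    also have "\<dots> \<le> V * L"
      unfolding V_def L_def sieving_primes_def by (rule ln_le_euler_factor_mult_sieve_mass)
    finally have "y / 5 * GL \<le> V * L * GL" using GL0 by (rule mult_right_mono)
    also have "\<dots> = V * (L * GL)" by simp
    also have "\<dots> \<le> V * (3 * real m * B_large Q * ?T)"
      unfolding L_def GL_def by (intro mult_left_mono V restriction_bound_large QN Q z0 EM)
    also have "\<dots> \<le> V * (3 * real m * B * ?T)"
      using V B_split[of Q] B_small_nonneg[of Q]
      by (intro mult_left_mono mult_right_mono add_nonneg_nonneg) auto
    finally have "N * (y / 5 * GL) \<le> N * (V * (3 * real m * B * ?T))"
      using N_ge by (intro mult_left_mono) auto
    also have "\<dots> = 3 * V * real m * (N * B) * ?T"
      by (simp only: mult_ac)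
    also have "\<dots> = 3 * V * real m * (X * y / 2) * ?T" unfolding y_def N_mult_B ..
    finally have *: "(y / 5) * (N * GL) \<le> (y / 5) * (15 / 2 * V * real m * X * ?T)"
      by (simp add: mult_ac)
    have "y / 5 > 0" using y by simp
    hence "N * GL \<le> 15 / 2 * V * real m * X * ?T"
      using * by (simp only: mult_le_cancel_left_pos)
    also have "\<dots> = 15 / 2 * V * X * real m + 45 / 2 * V / real z * (real N' * (real (card E) * X))"
    proof -
      have "real m * (3 * real (card E) / (real W * real z)) = 3 * real N' * real (card E) / real z"
        using W_pos by (simp add: m_def)
      hence "15 / 2 * V * X * (real m * (3 * real (card E) / (real W * real z)))
          = 15 / 2 * V * X * (3 * real N' * real (card E) / real z)" by (simp only:)
      also have "\<dots> = 45 / 2 * V / real z * (real N' * (real (card E) * X))" by simp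
      finally have "15 / 2 * V * X * (real m * (3 * real (card E) / (real W * real z)))
          = 45 / 2 * V / real z * (real N' * (real (card E) * X))" .
      moreover have "15 / 2 * V * real m * X * ?T
          = 15 / 2 * V * X * real m + 15 / 2 * V * X * (real m * (3 * real (card E) / (real W * real z)))"
        by (simp only: distrib_left mult_1_right mult_ac)
      ultimately show ?thesis by (simp only:)
    qed
    also have "\<dots> \<le> 15 / 2 * V * X * real m + 45 / 2 * (1 / 180) * (N * G)"
    proof (rule add_left_mono)
      have "real N' * (real (card E) * X) \<le> N * (4 ^ i * G)"
        by (rule mult_mono[OF N'_bounds(1) cardE]) (use N_ge X_nonneg in auto)
      hence "45 / 2 * V / real z * (real N' * (real (card E) * X)) \<le> 45 / 2 * V / real z * (N * (4 ^ i * G))"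
        using V z0 by (intro mult_left_mono) auto
      also have "\<dots> = 45 / 2 * (V * (4 ^ i / real z)) * (N * G)" by simp
      also have "\<dots> \<le> 45 / 2 * (1 / 180) * (N * G)"
        using Vz G0 N_ge by (intro mult_right_mono mult_left_mono) auto
      finally show "45 / 2 * V / real z * (real N' * (real (card E) * X)) \<le> 45 / 2 * (1 / 180) * (N * G)" .
    qed
    finally show ?thesis by simp
  qed
  have small: "N * GS \<le> N * G / 8"
  proof -
    have "GS \<le> (\<Sum>j\<in>E. real Q * B)"
      unfolding GS_def
    proof (rule sum_mono)
      fix j
      have "real Q * B_small Q \<le> real Q * B" using B_split[of Q] B_large_nonneg[of Q] by (intro mult_left_mono) auto
      thus "(norm (S_small Q j))\<^sup>2 \<le> real Q * B" using norm_S_small_le[of Q j] by linarith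
    qed
    hence "N * GS \<le> N * (real (card E) * (real Q * B))" using N_ge by (intro mult_left_mono) auto
    also have "\<dots> = real (card E) * real Q * (N * B)" by (simp only: mult_ac)
    also have "\<dots> = (real (card E) * X) * (real Q * y / 2)" unfolding y_def N_mult_B by simp
    also have "\<dots> \<le> (4 ^ i * G) * (real Q * y / 2)" using cardE y by (intro mult_right_mono) auto
    also have "\<dots> = (4 ^ i * real Q * y) * (G / 2)" by simp
    also have "\<dots> \<le> (N / 4) * (G / 2)" using Qy G0 by (intro mult_right_mono) auto
    finally show ?thesis by simp
  qed
  have "N * G \<le> N * (2 * GL + 2 * GS)" using GG N_ge by (intro mult_left_mono) auto
  also have "\<dots> = 2 * (N * GL) + 2 * (N * GS)" by (simp add: distrib_left)
  finally have "N * G \<le> 30 * V * X * real m"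
    using large small by linarith
  also have "\<dots> \<le> 30 * (171 + 34 * real i) * X * real m"
    using V X_nonneg by (intro mult_right_mono mult_left_mono) auto
  also have "\<dots> \<le> (5200 + 1020 * real i) * X * real m"
    using X_nonneg by (intro mult_right_mono) auto
  finally show ?thesis unfolding G_def .
qed

end

section \<open>Moments\<close>

text \<open>
  The coefficients telescope: the sum over \<open>i \<ge> i\<^sub>0\<close> together with the remainder \<open>r\<^sup>k\<close> equals \<open>r\<^bsup>i\<^sub>0\<^esup>\<close>, and if \<open>i\<^sub>0\<close> is the first
  level with \<open>X / 4\<^bsup>i\<^sub>0\<^esup> < s\<close> then \<open>s \<le> 4X / 4\<^bsup>i\<^sub>0\<^esup>\<close>.
\<close>
lemma powr_le_sum_level_sets:
  fixes s X h :: real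
  assumes "0 \<le> s" "s \<le> 4 * X" "h > 0"
  defines "r \<equiv> 2 powr (- h)"
  shows "s powr (h / 2) \<le> (4 * X) powr (h / 2) * ((\<Sum>i<k. if X / 4 ^ i < s then r ^ i - r ^ Suc i else 0) + r ^ k)"
proof (induction k)
  case 0
  show ?case using assms by (auto intro: powr_mono2)
next
  case (Suc k)
  show ?case
  proof (cases "X / 4 ^ k < s")
    case True
    thus ?thesis using Suc by simp
  next
    case False
    have X0: "X \<ge> 0" using assms by simp
    have none: "\<not> X / 4 ^ i < s" if "i < k" for i
    proof -
      have "X / 4 ^ k \<le> X / 4 ^ i" using X0 that by (intro divide_left_mono power_increasing) auto
      thus ?thesis using False by linarith
    qed
    have "s \<le> 4 * X / 4 ^ Suc k" using False by simp
    hence "s powr (h / 2) \<le> (4 * X / 4 ^ Suc k) powr (h / 2)" using assms by (intro powr_mono2) auto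
    also have "\<dots> = (4 * X) powr (h / 2) / (4 ^ Suc k) powr (h / 2)" by (rule powr_divide)
    also have "(4 ^ Suc k) powr (h / 2) = 1 / r ^ Suc k"
    proof -
      have "(4 ^ Suc k :: real) = 2 powr (2 * real (Suc k))"
        by (simp only: powr_realpow[symmetric] powr_powr[symmetric]) simp
      hence "(4 ^ Suc k :: real) powr (h / 2) = 2 powr (2 * real (Suc k) * (h / 2))" by (simp only: powr_powr)
      also have "2 * real (Suc k) * (h / 2) = h * real (Suc k)" by simp
      finally have "(4 ^ Suc k :: real) powr (h / 2) = 2 powr (h * real (Suc k))" .
      moreover have "r ^ Suc k = 2 powr (- (h * real (Suc k)))"
        unfolding r_def by (subst powr_realpow[symmetric]) (simp_all add: powr_powr)
      ultimately show ?thesis by (simp add: powr_minus_divide)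
    qed
    finally show ?thesis using False none by simp
  qed
qed

text \<open>
  Summation by parts.
\<close>
lemma sum_geometric_weights:
  fixes r a b :: real
  shows "(\<Sum>i<k. (r ^ i - r ^ Suc i) * (a + b * real i)) + r ^ k * (a + b * real k) = a + b * (\<Sum>i<k. r ^ Suc i)"
  by (induction k) (simp_all add: algebra_simps)

lemma sum_powr_geometric_le:
  fixes h :: real
  assumes "h > 0"
  shows "2 powr h * (\<Sum>i<k. (2 powr (- h)) ^ Suc i) \<le> 1 + 2 / h"
proof -
  let ?r = "2 powr (- h)"
  have r: "0 < ?r" "?r < 1" using assms by (simp_all add: powr_less_one)
  have "(\<Sum>i<k. ?r ^ Suc i) = ?r * (\<Sum>i<k. ?r ^ i)" by (simp add: sum_distrib_left)
  also have "(\<Sum>i<k. ?r ^ i) = (1 - ?r ^ k) / (1 - ?r)"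
    using r by (subst sum_gp_strict) auto
  also have "?r * ((1 - ?r ^ k) / (1 - ?r)) \<le> ?r * (1 / (1 - ?r))"
    using r by (intro mult_left_mono divide_right_mono) auto
  finally have "2 powr h * (\<Sum>i<k. ?r ^ Suc i) \<le> 2 powr h * (?r * (1 / (1 - ?r)))"
    by (intro mult_left_mono) auto
  also have "\<dots> = 1 / (1 - ?r)" by (simp add: powr_add[symmetric])
  also have "\<dots> \<le> 1 + 2 / h"
  proof -
    have "ln 2 \<ge> (1 / 2 :: real)" using ln2_ge_two_thirds by simp
    hence "h * (1 / 2) \<le> h * ln 2" using assms by (intro mult_left_mono) auto
    hence "1 + h / 2 \<le> exp (h * ln 2)" using exp_ge_add_one_self[of "h * ln 2"] by linarith
    hence "1 + h / 2 \<le> 2 powr h" by (simp add: powr_def)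
    hence "?r \<le> 1 / (1 + h / 2)" using assms by (simp add: powr_minus_divide frac_le)
    also have "1 / (1 + h / 2) = 1 - 1 / (1 + 2 / h)" using assms by (simp add: field_simps)
    finally have "1 / (1 + 2 / h) \<le> 1 - ?r" by simp
    hence "1 / (1 - ?r) \<le> 1 / (1 / (1 + 2 / h))" using assms by (intro divide_left_mono) (auto intro!: mult_pos_pos simp: r add_pos_pos)
    thus ?thesis by simp
  qed
  finally show ?thesis .
qed

context prime_interval
begin

text \<open>
  The number \<open>k\<close> of levels is chosen so that below the last one Parseval's identity gives a bound of the
  same shape \<open>c k\<close> as the level set estimate.
\<close>
lemma discrete_moment_bound:
  assumes h: "h > 0"
  shows "N * (\<Sum>j<m. norm (S j) powr (2 + h)) \<le> real m * (14000 * (2 powr h + 1 / h) * X powr (1 + h / 2))"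
proof -
  define r where "r = 2 powr (- h)"
  define A where "A = (4 * X) powr (h / 2)"
  define k where "k = nat \<lceil>ln N\<rceil>"
  define c where "c i = 5200 + 1020 * real i" for i :: nat
  let ?s = "\<lambda>j. (norm (S j))\<^sup>2"
  let ?E = "\<lambda>i. {j. j < m \<and> X / 4 ^ i < ?s j}"
  have r: "0 < r" "r < 1" using h by (simp_all add: r_def powr_less_one)
  have rr: "r ^ i - r ^ Suc i \<ge> 0" for i
    using r by (simp add: mult_le_cancel_right1 )
  have A0: "A \<ge> 0" by (simp add: A_def)
  have "N * (\<Sum>j<m. norm (S j) powr (2 + h))
     \<le> N * (\<Sum>j<m. A * ((\<Sum>i<k. if X / 4 ^ i < ?s j then (r ^ i - r ^ Suc i) * ?s j else 0) + r ^ k * ?s j))"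
  proof (intro mult_left_mono sum_mono)
    fix j
    have "norm (S j) powr (2 + h) = ?s j * (?s j) powr (h / 2)"
    proof (cases "S j = 0")
      case False
      hence "norm (S j) > 0" by simp
      moreover from this have "?s j = norm (S j) powr 2" by simp
      ultimately show ?thesis by (simp only: powr_powr powr_add) simp
    qed simp
    also have "\<dots> \<le> ?s j * (A * ((\<Sum>i<k. if X / 4 ^ i < ?s j then r ^ i - r ^ Suc i else 0) + r ^ k))"
      unfolding A_def r_def by (intro mult_left_mono powr_le_sum_level_sets norm_S_square_le h) auto
    also have "\<dots> = A * ((\<Sum>i<k. ?s j * (if X / 4 ^ i < ?s j then r ^ i - r ^ Suc i else 0)) + r ^ k * ?s j)"
      by (simp only: sum_distrib_left[symmetric] distrib_left mult_ac)
    also have "(\<Sum>i<k. ?s j * (if X / 4 ^ i < ?s j then r ^ i - r ^ Suc i else 0))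
             = (\<Sum>i<k. if X / 4 ^ i < ?s j then (r ^ i - r ^ Suc i) * ?s j else 0)"
      by (rule sum.cong) auto
    finally show "norm (S j) powr (2 + h)
      \<le> A * ((\<Sum>i<k. if X / 4 ^ i < ?s j then (r ^ i - r ^ Suc i) * ?s j else 0) + r ^ k * ?s j)" .
  qed (use N_ge in simp)
  also have "\<dots> = A * ((\<Sum>i<k. (r ^ i - r ^ Suc i) * (N * (\<Sum>j\<in>?E i. ?s j))) + r ^ k * (N * (\<Sum>j<m. ?s j)))"
  proof -
    have "(\<Sum>j<m. if X / 4 ^ i < ?s j then (r ^ i - r ^ Suc i) * ?s j else 0) = (r ^ i - r ^ Suc i) * (\<Sum>j\<in>?E i. ?s j)" for i
    proof -
      have "(\<Sum>j<m. if X / 4 ^ i < ?s j then (r ^ i - r ^ Suc i) * ?s j else 0) = (\<Sum>j\<in>{j\<in>{..<m}. X / 4 ^ i < ?s j}. (r ^ i - r ^ Suc i) * ?s j)"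
        by (rule sum.inter_filter[symmetric]) simp
      thus ?thesis by (simp add: sum_distrib_left)
    qed
    hence "(\<Sum>i<k. (r ^ i - r ^ Suc i) * (\<Sum>j\<in>?E i. ?s j)) = (\<Sum>j<m. \<Sum>i<k. if X / 4 ^ i < ?s j then (r ^ i - r ^ Suc i) * ?s j else 0)"
      by (subst sum.swap) (simp only:)
    hence "(\<Sum>j<m. A * ((\<Sum>i<k. if X / 4 ^ i < ?s j then (r ^ i - r ^ Suc i) * ?s j else 0) + r ^ k * ?s j))
       = A * ((\<Sum>i<k. (r ^ i - r ^ Suc i) * (\<Sum>j\<in>?E i. ?s j)) + r ^ k * (\<Sum>j<m. ?s j))"
      by (simp only: sum_distrib_left[symmetric] sum.distrib)
    thus ?thesis by (simp only: distrib_left sum_distrib_left mult.left_commute[of N])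
  qed
  also have "\<dots> \<le> A * ((\<Sum>i<k. (r ^ i - r ^ Suc i) * (c i * X * real m)) + r ^ k * (c k * X * real m))"
  proof (intro mult_left_mono add_mono sum_mono rr A0)
    show "N * (\<Sum>j\<in>?E i. ?s j) \<le> c i * X * real m" for i unfolding c_def by (rule sum_level_set_le)
    have "N * (\<Sum>j<m. ?s j) = real m * (N * B)" unfolding parseval by simp
    also have "\<dots> = ln N / 2 * (X * real m)" unfolding N_mult_B by simp
    also have "\<dots> \<le> c k * (X * real m)"
    proof (rule mult_right_mono)
      have "ln N \<le> real k" unfolding k_def by (rule real_nat_ceiling_ge)
      thus "ln N / 2 \<le> c k" unfolding c_def using lnN_pos by linarith
    qed (use X_nonneg in simp)
    finally show "N * (\<Sum>j<m. ?s j) \<le> c k * X * real m" by (simp only: mult.assoc)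
  qed (use r in auto)
  also have "\<dots> = A * (X * real m) * ((\<Sum>i<k. (r ^ i - r ^ Suc i) * c i) + r ^ k * c k)"
    by (simp only: sum_distrib_left distrib_left mult_ac)
  also have "\<dots> = A * (X * real m) * (5200 + 1020 * (\<Sum>i<k. r ^ Suc i))"
    unfolding c_def sum_geometric_weights ..
  also have "A = 2 powr h * X powr (h / 2)"
  proof -
    have "(4::real) powr (h / 2) = (2 powr 2) powr (h / 2)" by simp
    also have "\<dots> = 2 powr h" by (simp only: powr_powr) simp
    finally show ?thesis unfolding A_def using X_nonneg by (simp add: powr_mult)
  qed
  also have "2 powr h * X powr (h / 2) * (X * real m) * (5200 + 1020 * (\<Sum>i<k. r ^ Suc i))
     = (X powr (h / 2) * X) * real m * (5200 * 2 powr h + 1020 * (2 powr h * (\<Sum>i<k. r ^ Suc i)))"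
    by (simp add: algebra_simps)
  also have "X powr (h / 2) * X = X powr (1 + h / 2)"
    using X_nonneg by (cases "X = 0") (simp_all add: powr_add)
  also have "X powr (1 + h / 2) * real m * (5200 * 2 powr h + 1020 * (2 powr h * (\<Sum>i<k. r ^ Suc i)))
     \<le> X powr (1 + h / 2) * real m * (14000 * (2 powr h + 1 / h))"
  proof (rule mult_left_mono)
    have "2 powr h * (\<Sum>i<k. r ^ Suc i) \<le> 1 + 2 / h" unfolding r_def by (rule sum_powr_geometric_le[OF h])
    moreover have "1 \<le> 2 powr h" using h by (simp add: ge_one_powr_ge_zero)
    moreover have "1 / h \<ge> 0" "2 / h = 2 * (1 / h)" using h by simp_all
    ultimately show "5200 * 2 powr h + 1020 * (2 powr h * (\<Sum>i<k. r ^ Suc i)) \<le> 14000 * (2 powr h + 1 / h)"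
      unfolding distrib_left by linarith
  qed simp
  finally show ?thesis by (simp only: mult_ac)
qed

end

lemma integral_unit_interval_eq_sum_translates:
  fixes f :: "real \<Rightarrow> real"
  assumes cont: "continuous_on UNIV f" and m: "m > 0"
  shows "integral {0..1} f = integral {0..1 / real m} (\<lambda>t. \<Sum>j<m. f (real j / real m + t))"
proof -
  have int: "f integrable_on {a..b}" for a b
    by (intro integrable_continuous_interval continuous_on_subset[OF cont]) auto
  have shift: "integral {a..a + d} f = integral {0..d} (\<lambda>t. f (a + t))" for a d
  proof -
    have "((\<lambda>t. f (1 *\<^sub>R t + a)) has_integral (1 / \<bar>1\<bar> ^ DIM(real)) *\<^sub>R integral (cbox a (a + d)) f)
            ((\<lambda>x. (1 / 1) *\<^sub>R x + - ((1 / 1) *\<^sub>R a)) ` cbox a (a + d))"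
      by (rule has_integral_affinity) (use int in \<open>auto simp: integrable_integral\<close>)
    moreover have "(\<lambda>x. (1 / 1) *\<^sub>R x + - ((1 / 1) *\<^sub>R a)) ` cbox a (a + d) = {0..d}"
      by (auto simp: image_iff intro!: bexI[of _ "_ + a"])
    ultimately show ?thesis by (simp add: integral_unique add.commute)
  qed
  have "integral {0..real k / real m} f = (\<Sum>j<k. integral {0..1 / real m} (\<lambda>t. f (real j / real m + t)))" for k
  proof (induction k)
    case (Suc k)
    have "integral {0..real (Suc k) / real m} f
        = integral {0..real k / real m} f + integral {real k / real m..real (Suc k) / real m} f"
      by (rule Henstock_Kurzweil_Integration.integral_combine[symmetric])
         (use m int in \<open>auto simp: divide_right_mono\<close>)
    also have "integral {real k / real m..real (Suc k) / real m} f = integral {0..1 / real m} (\<lambda>t. f (real k / real m + t))"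
      using shift[of "real k / real m" "1 / real m"] by (simp add: add_divide_distrib add.commute)
    finally show ?case using Suc by simp
  qed simp
  from this[of m] have "integral {0..1} f = (\<Sum>j<m. integral {0..1 / real m} (\<lambda>t. f (real j / real m + t)))"
    using m by simp
  also have "\<dots> = integral {0..1 / real m} (\<lambda>t. \<Sum>j<m. f (real j / real m + t))"
    by (rule integral_sum[symmetric])
       (auto intro!: integrable_continuous_interval continuous_intros continuous_on_compose2[OF cont])
  finally show ?thesis .
qed

theorem corollary10p3:
  fixes N M h :: real and u :: "nat \<Rightarrow> complex"
  assumes "N \<ge> 1000" and "M \<ge> 0" and "h > 0"
  shows "integral {0..1}
           (\<lambda>\<alpha>::real. norm (\<Sum>p\<in>primes_between (M + 1) (M + N). u p * e (real p * \<alpha>)) powr (2 + h))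
         \<le> 14000 * ((2 powr h + 1 / h) / N) *
           (2 * N / ln N * (\<Sum>p\<in>primes_between (M + 1) (M + N). (norm (u p))\<^sup>2)) powr (1 + h / 2)"
proof -
  interpret pi: prime_interval N M u using assms by unfold_locales
  let ?J = "primes_between (M + 1) (M + N)"
  define f where "f \<alpha> = norm (\<Sum>p\<in>?J. u p * e (real p * \<alpha>)) powr (2 + h)" for \<alpha> :: real
  define R where "R = 14000 * (2 powr h + 1 / h) * pi.X powr (1 + h / 2) / N"
  have m: "pi.m > 0" by (rule pi.m_pos)
  have cont: "continuous_on UNIV f"
    unfolding f_def e_def using assms by (intro continuous_on_powr' continuous_intros) auto
  have bound: "(\<Sum>j<pi.m. f (real j / real pi.m + t)) \<le> real pi.m * R" for t
  proof -
    \<comment> \<open>Twisting the coefficients translates the grid by \<open>t\<close> and leaves \<open>X\<close> unchanged.\<close>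
    interpret tw: prime_interval N M "\<lambda>n. u n * e (real n * t)" using assms by unfold_locales
    have XX: "tw.X = pi.X"
      by (simp add: tw.X_def pi.X_def tw.B_def pi.B_def tw.J_def pi.J_def norm_mult)
    have "norm (tw.S j) powr (2 + h) = f (real j / real pi.m + t)" for j
    proof -
      have "e (real n * (real j / real pi.m + t)) = e (real n * t) * e (real n * (real j / real pi.m))" for n
        unfolding e_add[symmetric] by (simp add: distrib_left add.commute)
      hence "u n * e (real n * t) * e (real n * (real j / real pi.m)) = u n * e (real n * (real j / real pi.m + t))" for n
        by (simp only: mult.assoc)
      thus ?thesis unfolding f_def tw.S_def expsum_def tw.J_def by (simp only:)
    qed
    hence "N * (\<Sum>j<pi.m. f (real j / real pi.m + t)) \<le> real pi.m * (14000 * (2 powr h + 1 / h) * pi.X powr (1 + h / 2))"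
      using tw.discrete_moment_bound[OF assms(3)] unfolding XX by simp
    thus ?thesis unfolding R_def using assms by (simp add: pos_le_divide_eq mult_ac)
  qed
  have "integral {0..1} f = integral {0..1 / real pi.m} (\<lambda>t. \<Sum>j<pi.m. f (real j / real pi.m + t))"
    by (rule integral_unit_interval_eq_sum_translates[OF cont m])
  also have "\<dots> \<le> integral {0..1 / real pi.m} (\<lambda>t. real pi.m * R)"
    by (rule integral_le)
       (auto intro!: bound integrable_continuous_interval continuous_intros continuous_on_compose2[OF cont])
  also have "\<dots> = R" using m by simp
  finally show ?thesis
    unfolding f_def R_def pi.X_def pi.B_def pi.J_def by simp
qed

end
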